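(* Let $\mathbf V\subseteq\mathbf V^*$ be universes of set theory (models of ZFC), and let $h\in\omega^\omega\cap\mathbf V$ be strictly increasing. Suppose that in $\mathbf V^*$ there is $\eta\in\prod_{n\in\omega}h(n)$ such that for every $\rho\in\prod_{n\in\omega}h(n)\cap\mathbf V$ we have $\rho(n)\ne\eta(n)$ for all but finitely many $n$. Then there is an infinite set $X\subseteq\omega$, $X\in\mathbf V^*$, such that in $\mathbf V^*$: for every $f\in\omega^\omega\cap\mathbf V$ with $n<f(n)$ for all $n\in\omega$, the set $\{m\in X:f(m)\in X\}$ is finite. In particular, the set $\omega\setminus X$ is $(2,0)$-large over $\mathbf V$.
   Context: $\prod_{n}h(n)$ is the set of functions $\eta$ on $\omega$ with $\eta(n)<h(n)$. An infinite co-infinite set $Y\subseteq\omega$, $Y\in\mathbf V^*$, is $(2,0)$-large over $\mathbf V$ if for every sequence $\langle K_n:n\in\omega\rangle\in\mathbf V$ of pairwise disjoint 2-element subsets of $\omega$, $K_n\cap Y\ne\emptyset$ for all but finitely many $n$. *)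

theory Defs
  imports Main
begin

text \<open>
  Universes of set theory are arbitrary first-order structures for the language of set theory that
  satisfy ZFC. They need not be well-founded or countable, so every set-theoretic notion below
  (natural number, function, finite set, ...) is the notion of the universe it is indexed by,
  not that of HOL.
\<close>

record 'a set_structure =
  elems :: "'a set"
  mem :: "'a \<Rightarrow> 'a \<Rightarrow> bool" (infix "\<epsilon>\<index>" 50)

text \<open>The HOL set of those objects of the universe that are members of \<open>x\<close>.\<close>

definition ext :: "'a set_structure \<Rightarrow> 'a \<Rightarrow> 'a set" where
  "ext V x = {z \<in> elems V. z \<epsilon>\<^bsub>V\<^esub> x}"

text \<open>A class (HOL set of objects) that is a set in the sense of the universe.\<close>

definition is_set :: "'a set_structure \<Rightarrow> 'a set \<Rightarrow> bool" where
  "is_set V S \<longleftrightarrow> (\<exists>x\<in>elems V. ext V x = S)"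

datatype fm =
    Mem nat nat
  | Equal nat nat
  | Neg fm
  | Conj fm fm
  | Forall nat fm

primrec sat :: "'a set_structure \<Rightarrow> (nat \<Rightarrow> 'a) \<Rightarrow> fm \<Rightarrow> bool" where
  "sat V a (Mem i j) \<longleftrightarrow> a i \<epsilon>\<^bsub>V\<^esub> a j"
| "sat V a (Equal i j) \<longleftrightarrow> a i = a j"
| "sat V a (Neg \<phi>) \<longleftrightarrow> \<not> sat V a \<phi>"
| "sat V a (Conj \<phi> \<psi>) \<longleftrightarrow> sat V a \<phi> \<and> sat V a \<psi>"
| "sat V a (Forall i \<phi>) \<longleftrightarrow> (\<forall>x\<in>elems V. sat V (a(i := x)) \<phi>)"

definition is_inductive :: "'a set_structure \<Rightarrow> 'a \<Rightarrow> bool" where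
  "is_inductive V x \<longleftrightarrow> x \<in> elems V \<and>
     (\<exists>e\<in>ext V x. ext V e = {}) \<and>
     (\<forall>y\<in>ext V x. \<exists>s\<in>ext V x. ext V s = insert y (ext V y))"

text \<open>
  In the two schemes, \<open>\<phi>\<close> ranges over first-order formulas and the assignment \<open>a\<close> supplies
  the parameters.
\<close>

definition zfc_model :: "'a set_structure \<Rightarrow> bool" where
  "zfc_model V \<longleftrightarrow>
     \<comment> \<open>Extensionality\<close>
     (\<forall>x\<in>elems V. \<forall>y\<in>elems V. ext V x = ext V y \<longrightarrow> x = y) \<and>
     \<comment> \<open>Foundation\<close>
     (\<forall>x\<in>elems V. ext V x \<noteq> {} \<longrightarrow> (\<exists>y\<in>ext V x. ext V y \<inter> ext V x = {})) \<and>
     \<comment> \<open>Pairing\<close>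
     (\<forall>x\<in>elems V. \<forall>y\<in>elems V. is_set V {x, y}) \<and>
     \<comment> \<open>Union\<close>
     (\<forall>x\<in>elems V. is_set V (\<Union>y\<in>ext V x. ext V y)) \<and>
     \<comment> \<open>Power set\<close>
     (\<forall>x\<in>elems V. is_set V {y \<in> elems V. ext V y \<subseteq> ext V x}) \<and>
     \<comment> \<open>Infinity\<close>
     (\<exists>x. is_inductive V x) \<and>
     \<comment> \<open>Separation\<close>
     (\<forall>\<phi> a. range a \<subseteq> elems V \<longrightarrow>
        (\<forall>x\<in>elems V. is_set V {z \<in> ext V x. sat V (a(0 := z)) \<phi>})) \<and>
     \<comment> \<open>Replacement\<close>
     (\<forall>\<phi> a. range a \<subseteq> elems V \<longrightarrow>
        (\<forall>x\<in>elems V.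
           (\<forall>z\<in>ext V x. \<exists>!y. y \<in> elems V \<and> sat V (a(0 := z, 1 := y)) \<phi>) \<longrightarrow>
           is_set V {y \<in> elems V. \<exists>z\<in>ext V x. sat V (a(0 := z, 1 := y)) \<phi>})) \<and>
     \<comment> \<open>Choice\<close>
     (\<forall>x\<in>elems V.
        (\<forall>y\<in>ext V x. ext V y \<noteq> {}) \<and>
        (\<forall>y\<in>ext V x. \<forall>z\<in>ext V x. y \<noteq> z \<longrightarrow> ext V y \<inter> ext V z = {}) \<longrightarrow>
        (\<exists>c\<in>elems V. \<forall>y\<in>ext V x. \<exists>!z. z \<in> ext V c \<inter> ext V y))"

text \<open>
  For universes, \<open>V \<subseteq> V\<^sup>*\<close> means that the smaller one is a transitive class of the larger
  one with the same membership relation. That the two have the same ordinals is not required.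
\<close>

definition subuniverse ::
    "'a set_structure \<Rightarrow> 'a set_structure \<Rightarrow> bool" where
  "subuniverse V W \<longleftrightarrow>
     elems V \<subseteq> elems W \<and>
     (\<forall>x\<in>elems V. \<forall>y\<in>elems V. x \<epsilon>\<^bsub>V\<^esub> y \<longleftrightarrow> x \<epsilon>\<^bsub>W\<^esub> y) \<and>
     (\<forall>x\<in>elems V. ext W x \<subseteq> elems V)"

text \<open>
  The object with a given extension. It exists and is unique whenever it is used below for
  a model of ZFC.
\<close>

definition the_set :: "'a set_structure \<Rightarrow> 'a set \<Rightarrow> 'a" where
  "the_set V S = (THE x. x \<in> elems V \<and> ext V x = S)"

definition omega :: "'a set_structure \<Rightarrow> 'a" where
  "omega V = the_set V {n \<in> elems V. \<forall>x. is_inductive V x \<longrightarrow> n \<in> ext V x}"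

definition opair :: "'a set_structure \<Rightarrow> 'a \<Rightarrow> 'a \<Rightarrow> 'a" where
  "opair V x y = the_set V {the_set V {x}, the_set V {x, y}}"

definition function_on :: "'a set_structure \<Rightarrow> 'a \<Rightarrow> 'a \<Rightarrow> bool" where
  "function_on V f a \<longleftrightarrow> f \<in> elems V \<and>
     ext V f \<subseteq> {opair V x y |x y. x \<in> ext V a \<and> y \<in> elems V} \<and>
     (\<forall>x\<in>ext V a. \<exists>!y. y \<in> elems V \<and> opair V x y \<in> ext V f)"

definition app :: "'a set_structure \<Rightarrow> 'a \<Rightarrow> 'a \<Rightarrow> 'a" where
  "app V f x = (THE y. y \<in> elems V \<and> opair V x y \<in> ext V f)"

text \<open>
  Finiteness in the sense of the universe: the class is a set that the universe puts in
  bijection with one of its natural numbers (a von Neumann numeral, i.e. the set of its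
  predecessors).
\<close>

definition finite_in :: "'a set_structure \<Rightarrow> 'a set \<Rightarrow> bool" where
  "finite_in V S \<longleftrightarrow> is_set V S \<and>
     (\<exists>n\<in>ext V (omega V). \<exists>g. function_on V g n \<and> bij_betw (app V g) (ext V n) S)"

definition almost_all :: "'a set_structure \<Rightarrow> ('a \<Rightarrow> bool) \<Rightarrow> bool" where
  "almost_all V P \<longleftrightarrow> finite_in V {n \<in> ext V (omega V). \<not> P n}"

text \<open>The order on \<open>\<omega>\<close> is membership, so \<open>m < n\<close> is rendered as \<open>m \<epsilon> n\<close>.\<close>

definition baire :: "'a set_structure \<Rightarrow> 'a set" where
  "baire V = {f. function_on V f (omega V) \<and>
     (\<forall>n\<in>ext V (omega V). app V f n \<in> ext V (omega V))}"

definition product :: "'a set_structure \<Rightarrow> 'a \<Rightarrow> 'a set" where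
  "product V h = {\<eta>. function_on V \<eta> (omega V) \<and>
     (\<forall>n\<in>ext V (omega V). app V \<eta> n \<epsilon>\<^bsub>V\<^esub> app V h n)}"

text \<open>\<open>Y\<close> is (2,0)-large over \<open>V\<close>, where \<open>W\<close> is the larger universe.\<close>

definition large_2_0 ::
    "'a set_structure \<Rightarrow> 'a set_structure \<Rightarrow> 'a \<Rightarrow> bool" where
  "large_2_0 V W Y \<longleftrightarrow>
     Y \<in> elems W \<and> ext W Y \<subseteq> ext W (omega W) \<and>
     \<not> finite_in W (ext W Y) \<and> \<not> finite_in W (ext W (omega W) - ext W Y) \<and>
     (\<forall>K\<in>elems V.
        function_on W K (omega W) \<and>
        (\<forall>n\<in>ext W (omega W). \<exists>a\<in>ext W (omega W). \<exists>b\<in>ext W (omega W).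
           a \<noteq> b \<and> ext W (app W K n) = {a, b}) \<and>
        (\<forall>m\<in>ext W (omega W). \<forall>n\<in>ext W (omega W).
           m \<noteq> n \<longrightarrow> ext W (app W K m) \<inter> ext W (app W K n) = {}) \<longrightarrow>
        almost_all W (\<lambda>n. ext W (app W K n) \<inter> ext W Y \<noteq> {}))"

end

theory Submission
  imports Defs
begin

text \<open>
  In \<open>V\<close> make \<open>\<omega>\<close> a tree in which every \<open>s\<close> has, for each \<open>b < h s\<close>, a child above \<open>s\<close> labelled \<open>b\<close>.
  In \<open>W\<close> let \<open>X\<close> be the branch from 0 that leaves \<open>s\<close> along the label \<open>\<eta> s\<close>. If \<open>s < t\<close> are in \<open>X\<close>, then
  \<open>V\<close> can read off \<open>\<eta> s\<close> from \<open>s\<close> and \<open>t\<close>, as the label of the child of \<open>s\<close> below \<open>t\<close>. Hence \<open>f\<close> in \<open>V\<close>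
  yields \<open>\<rho>\<close> in \<open>V\<close> with \<open>\<rho> s = \<eta> s\<close> whenever \<open>s\<close> and \<open>f s\<close> are in \<open>X\<close>, so this happens only finitely
  often. For disjoint pairs \<open>K n\<close> apply this to the function mapping \<open>min (K n)\<close> to \<open>max (K n)\<close>.
\<close>

section \<open>Definability with parameters\<close>

text \<open>The obstacle is that \<open>V\<close> and \<open>W\<close> may be ill-founded, with
  natural numbers that HOL does not see as such. HOL induction and recursion say nothing about them:
  only sets of a universe can be inducted over, so every predicate involved must be first-order
  definable with parameters, and every recursively described object must be obtained as a set by
  Separation. The roles of the two universes are forced. The condition n < f n puts the two points
  in the right order: the later one, f n, shows the label chosen at n. As the argument moves between
  the universes, their natural numbers, pairs and function values must be shown to agree, which
  follows from the transitivity of \<open>V\<close> in \<open>W\<close>.\<close>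

primrec rename :: "(nat \<Rightarrow> nat) \<Rightarrow> fm \<Rightarrow> fm" where
  "rename f (Mem i j) = Mem (f i) (f j)"
| "rename f (Equal i j) = Equal (f i) (f j)"
| "rename f (Neg \<phi>) = Neg (rename f \<phi>)"
| "rename f (Conj \<phi> \<psi>) = Conj (rename f \<phi>) (rename f \<psi>)"
| "rename f (Forall i \<phi>) = Forall (f i) (rename f \<phi>)"

text \<open>Bound variables are renamed along with free ones. Injectivity keeps them apart: updating
  position \<open>f i\<close> changes the composed assignment at \<open>i\<close> and nowhere
  else.\<close>

lemma sat_rename:
  assumes "inj f"
  shows "sat V a (rename f \<phi>) \<longleftrightarrow> sat V (a \<circ> f) \<phi>"
proof (induction \<phi> arbitrary: a)
  case (Forall i \<phi>)
  have *: "a(f i := x) \<circ> f = (a \<circ> f)(i := x)" for x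
    using assms by (auto simp: fun_eq_iff inj_eq)
  show ?case by (simp only: rename.simps sat.simps Forall.IH *)
qed auto

text \<open>
  Definability with parameters, on environments read as de Bruijn stacks. Working with HOL
  predicates instead of \<open>fm\<close> lets definability be checked by introduction rules.
\<close>

inductive definable :: "'a set_structure \<Rightarrow> ((nat \<Rightarrow> 'a) \<Rightarrow> bool) \<Rightarrow> bool" for V where
  mem_var: "definable V (\<lambda>e. e i \<epsilon>\<^bsub>V\<^esub> e j)"
| eq_var: "definable V (\<lambda>e. e i = e j)"
| neg: "definable V P \<Longrightarrow> definable V (\<lambda>e. \<not> P e)"
| conj: "definable V P \<Longrightarrow> definable V Q \<Longrightarrow> definable V (\<lambda>e. P e \<and> Q e)"
| all: "definable V P \<Longrightarrow> definable V (\<lambda>e. \<forall>x\<in>elems V. P (case_nat x e))"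
| parameter: "definable V P \<Longrightarrow> c \<in> elems V \<Longrightarrow> definable V (\<lambda>e. P (case_nat c e))"
| cong: "definable V P \<Longrightarrow> (\<And>e. range e \<subseteq> elems V \<Longrightarrow> P e \<longleftrightarrow> Q e) \<Longrightarrow> definable V Q"

lemma range_case_nat: "range e \<subseteq> S \<Longrightarrow> x \<in> S \<Longrightarrow> range (case_nat x e) \<subseteq> S"
  by (fastforce split: nat.splits)

text \<open>Unlike in the renaming of formulas, \<open>r\<close> may identify variables, since only
  the derivation is replayed. Below \<open>all\<close> and \<open>parameter\<close> the induction
  hypothesis is used for \<open>r\<close> lifted past the new entry: 0 is fixed and
  \<open>Suc i\<close> goes to \<open>Suc (r i)\<close>.\<close>

lemma definable_rename: "definable V P \<Longrightarrow> definable V (\<lambda>e. P (\<lambda>i. e (r i)))"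
proof (induction arbitrary: r rule: definable.induct)
  case (mem_var i j) show ?case by (rule definable.mem_var)
next
  case (eq_var i j) show ?case by (rule definable.eq_var)
next
  case (neg P) then show ?case by (intro definable.neg)
next
  case (conj P Q) then show ?case by (intro definable.conj)
next
  case (all P)
  have *: "(\<lambda>i. case_nat x e (case_nat 0 (\<lambda>i. Suc (r i)) i)) = case_nat x (\<lambda>i. e (r i))" for x e
    by (auto simp: fun_eq_iff split: nat.splits)
  show ?case using definable.all[OF all.IH[of "case_nat 0 (\<lambda>i. Suc (r i))"]] by (simp only: *)
next
  case (parameter P c)
  have *: "(\<lambda>i. case_nat c e (case_nat 0 (\<lambda>i. Suc (r i)) i)) = case_nat c (\<lambda>i. e (r i))" for e
    by (auto simp: fun_eq_iff split: nat.splits)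
  show ?case
    using definable.parameter[OF parameter.IH[of "case_nat 0 (\<lambda>i. Suc (r i))"] parameter.hyps(2)]
    by (simp only: *)
next
  case (cong P Q)
  have "P (\<lambda>i. e (r i)) \<longleftrightarrow> Q (\<lambda>i. e (r i))" if "range e \<subseteq> elems V" for e
    by (rule cong.hyps(2)) (use that in auto)
  then show ?case by (rule definable.cong[OF cong.IH])
qed

section \<open>Stacks and their parameters coded in one assignment\<close>

definition interleave :: "(nat \<Rightarrow> 'a) \<Rightarrow> (nat \<Rightarrow> 'a) \<Rightarrow> nat \<Rightarrow> 'a" where
  "interleave e p i = (if even i then e (i div 2) else p (i div 2))"

lemma range_interleave: "range e \<subseteq> S \<Longrightarrow> range p \<subseteq> S \<Longrightarrow> range (interleave e p) \<subseteq> S"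
  by (auto simp: interleave_def)

lemma interleave_push:
  "\<exists>f. inj f \<and> (\<forall>x y (e :: nat \<Rightarrow> 'a) p.
     (interleave e (case_nat y p))(1 := x) \<circ> f = interleave (case_nat x e) p)"
proof (intro exI conjI allI)
  \<comment> \<open>Pushing x moves the stack from positions 2k to 2k+2. The map reads the new top
    at position 1, where the update has put x, and skips that position when it reads the
    parameters.\<close>
  let ?f = "\<lambda>j::nat. if j = 0 then 1 else if even j then j - 2 else j + 2"
  show "inj ?f"
  proof (rule inj_on_inverseI)
    fix j :: nat
    show "(\<lambda>i. if i = 1 then 0 else if even i then i + 2 else i - 2) (?f j) = j"
    proof (cases "even j")
      case True
      then obtain k where "j = 2 * k" by (rule evenE)
      then show ?thesis by (cases k) auto
    qed auto
  qed
  show "(interleave e (case_nat y p))(1 := x) \<circ> ?f = interleave (case_nat x e) p"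
    for x y and e p :: "nat \<Rightarrow> 'a"
  proof
    fix i
    consider "i = 0" | k where "i = 2 * Suc k" | k where "i = 2 * k + 1"
      by (metis evenE mult_0_right not0_implies_Suc oddE)
    then show "((interleave e (case_nat y p))(1 := x) \<circ> ?f) i = interleave (case_nat x e) p i"
      by cases (simp_all add: interleave_def)
  qed
qed

lemma interleave_merge:
  "\<exists>f g. inj f \<and> inj g \<and> (\<forall>(e :: nat \<Rightarrow> 'a) p q.
     interleave e (interleave p q) \<circ> f = interleave e p \<and>
     interleave e (interleave p q) \<circ> g = interleave e q)"
proof (intro exI conjI allI)
  \<comment> \<open>Odd positions 2k+1 go to 4k+c: c = 1 reads the first of the merged parameter
    lists and c = 3 the second. The stack at the even positions stays in place.\<close>
  let ?f = "\<lambda>c j::nat. if even j then j else 4 * (j div 2) + c"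
  have *: "inj (?f c)" if c: "c = 1 \<or> c = 3" for c
  proof (rule inj_on_inverseI)
    fix j :: nat
    show "(\<lambda>i. if even i then i else 2 * (i div 4) + 1) (?f c j) = j"
    proof (cases "even j")
      case False
      then obtain k where "j = 2 * k + 1" by (rule oddE)
      with c show ?thesis by auto
    qed simp
  qed
  show "inj (?f 1)" "inj (?f 3)" by (simp_all add: *)
  show "interleave e (interleave p q) \<circ> ?f 1 = interleave e p"
    "interleave e (interleave p q) \<circ> ?f 3 = interleave e q" for e p q :: "nat \<Rightarrow> 'a"
  proof -
    have "(4 * k + 3) div 2 = Suc (2 * k)" for k :: nat by simp
    then show "interleave e (interleave p q) \<circ> ?f 1 = interleave e p"
      "interleave e (interleave p q) \<circ> ?f 3 = interleave e q"
      by (auto simp: fun_eq_iff interleave_def elim!: oddE simp del: div_mult_self1 div_mult_self2 div_mult_self3 div_mult_self4)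
  qed
qed

text \<open>Opens the axiom schemes, which speak of formulas, to \<open>definable\<close>
  predicates. One list \<open>p\<close> must serve all stacks, hence it is chosen before
  \<open>e\<close>. With the stack at even and the parameters at odd positions, neither supply runs
  out.\<close>

lemma definable_imp_fm:
  assumes "definable V P" "elems V \<noteq> {}"
  shows "\<exists>\<phi> p. range p \<subseteq> elems V \<and>
    (\<forall>e. range e \<subseteq> elems V \<longrightarrow> P e = sat V (interleave e p) \<phi>)"
  using assms(1)
proof induction
  case (mem_var i j)
  obtain c where "c \<in> elems V" using assms(2) by blast
  then show ?case
    by (intro exI[of _ "Mem (2*i) (2*j)"] exI[of _ "\<lambda>_. c"]) (auto simp: interleave_def)
next
  case (eq_var i j)
  obtain c where "c \<in> elems V" using assms(2) by blast
  then show ?case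
    by (intro exI[of _ "Equal (2*i) (2*j)"] exI[of _ "\<lambda>_. c"]) (auto simp: interleave_def)
next
  case (neg P)
  then obtain \<phi> p where "range p \<subseteq> elems V"
    "\<And>e. range e \<subseteq> elems V \<Longrightarrow> P e = sat V (interleave e p) \<phi>" by blast
  then show ?case by (intro exI[of _ "Neg \<phi>"] exI[of _ p]) auto
next
  case (conj P Q)
  obtain \<phi> p where p: "range p \<subseteq> elems V"
    "\<And>e. range e \<subseteq> elems V \<Longrightarrow> P e = sat V (interleave e p) \<phi>" using conj.IH(1) by blast
  obtain \<psi> q where q: "range q \<subseteq> elems V"
    "\<And>e. range e \<subseteq> elems V \<Longrightarrow> Q e = sat V (interleave e q) \<psi>" using conj.IH(2) by blast
  obtain f g where "inj f" "inj g" "\<And>e. interleave e (interleave p q) \<circ> f = interleave e p"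
    "\<And>e. interleave e (interleave p q) \<circ> g = interleave e q"
    using interleave_merge[where ?'a='a] by auto
  then show ?case using p q range_interleave[OF p(1) q(1)]
    by (intro exI[of _ "Conj (rename f \<phi>) (rename g \<psi>)"] exI[of _ "interleave p q"])
      (simp add: sat_rename)
next
  case (all P)
  obtain \<phi> p where p: "range p \<subseteq> elems V"
    "\<And>e. range e \<subseteq> elems V \<Longrightarrow> P e = sat V (interleave e p) \<phi>" using all.IH by blast
  obtain c where c: "c \<in> elems V" using assms(2) by blast
  obtain f where f: "inj f" "\<And>x e. (interleave e (case_nat c p))(1 := x) \<circ> f = interleave (case_nat x e) p"
    using interleave_push[where ?'a='a] by blast
  \<comment> \<open>The quantifier binds variable 1, the first parameter slot, because position 0 is
    already the top of the stack \<open>e\<close>. There \<open>c\<close> is only a filler that gets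
    overwritten.\<close>
  show ?case
  proof (intro exI conjI allI impI)
    show "range (case_nat c p) \<subseteq> elems V" using range_case_nat[OF p(1) c] .
    fix e :: "nat \<Rightarrow> 'a" assume "range e \<subseteq> elems V"
    then have "P (case_nat x e) = sat V (interleave (case_nat x e) p) \<phi>" if "x \<in> elems V" for x
      using p(2)[OF range_case_nat] that by blast
    then show "(\<forall>x\<in>elems V. P (case_nat x e)) =
        sat V (interleave e (case_nat c p)) (Forall 1 (rename f \<phi>))"
      by (simp add: sat_rename[OF f(1)] f(2)[simplified])
  qed
next
  case (parameter P c)
  obtain \<phi> p where p: "range p \<subseteq> elems V"
    "\<And>e. range e \<subseteq> elems V \<Longrightarrow> P e = sat V (interleave e p) \<phi>" using parameter.IH by blast
  obtain f where f: "inj f" "\<And>x e. (interleave e (case_nat c p))(1 := x) \<circ> f = interleave (case_nat x e) p"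
    using interleave_push[where ?'a='a] by blast
  \<comment> \<open>Now slot 1 holds the true parameter \<open>c\<close>, so the update that
    imitates a push changes nothing and the renamed formula can stay without a quantifier.\<close>
  have [simp]: "(interleave e (case_nat c p))(Suc 0 := c) = interleave e (case_nat c p)" for e
    by (auto simp: interleave_def fun_eq_iff)
  show ?case
  proof (intro exI conjI allI impI)
    show "range (case_nat c p) \<subseteq> elems V" using range_case_nat[OF p(1) parameter.hyps(2)] .
    fix e :: "nat \<Rightarrow> 'a" assume "range e \<subseteq> elems V"
    then have "P (case_nat c e) = sat V (interleave (case_nat c e) p) \<phi>"
      using p(2)[OF range_case_nat] parameter.hyps(2) by blast
    also have "interleave (case_nat c e) p = interleave e (case_nat c p) \<circ> f"
      using f(2)[where x=c and e=e] by simp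
    finally show "P (case_nat c e) = sat V (interleave e (case_nat c p)) (rename f \<phi>)"
      by (simp only: sat_rename[OF f(1)])
  qed
next
  case (cong P Q)
  then show ?case by metis
qed

section \<open>Terms with definable graph and closure rules\<close>

definition definable_term :: "'a set_structure \<Rightarrow> ((nat \<Rightarrow> 'a) \<Rightarrow> 'a) \<Rightarrow> bool" where
  "definable_term V t \<longleftrightarrow> (\<forall>e. range e \<subseteq> elems V \<longrightarrow> t e \<in> elems V) \<and>
     definable V (\<lambda>e. e 0 = t (\<lambda>i. e (Suc i)))"

lemma definable_term_elems: "definable_term V t \<Longrightarrow> range e \<subseteq> elems V \<Longrightarrow> t e \<in> elems V"
  by (simp add: definable_term_def)

lemma definable_const: "definable V (\<lambda>e. Q)"
proof -
  have "definable V (\<lambda>e. e 0 = e 0)" by (rule definable.eq_var)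
  then have "definable V (\<lambda>e. True)" by simp
  with definable.neg[OF this] show ?thesis by (cases Q) auto
qed

lemma definable_disj: "definable V P \<Longrightarrow> definable V Q \<Longrightarrow> definable V (\<lambda>e. P e \<or> Q e)"
  using definable.neg[OF definable.conj[OF definable.neg[of V P] definable.neg[of V Q]]] by simp

lemma definable_imp: "definable V P \<Longrightarrow> definable V Q \<Longrightarrow> definable V (\<lambda>e. P e \<longrightarrow> Q e)"
  using definable.neg[OF definable.conj[OF _ definable.neg[of V Q]], of P] by simp

lemma definable_iff: "definable V P \<Longrightarrow> definable V Q \<Longrightarrow> definable V (\<lambda>e. P e \<longleftrightarrow> Q e)"
  using definable.conj[OF definable_imp[of V P Q] definable_imp[of V Q P]]
  by (simp add: iff_conv_conj_imp)

lemma definable_all: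
  "definable V (\<lambda>e. Q (e 0) (\<lambda>i. e (Suc i))) \<Longrightarrow> definable V (\<lambda>e. \<forall>x\<in>elems V. Q x e)"
  using definable.all[of V "\<lambda>e. Q (e 0) (\<lambda>i. e (Suc i))"] by simp

lemma definable_ex:
  "definable V (\<lambda>e. Q (e 0) (\<lambda>i. e (Suc i))) \<Longrightarrow> definable V (\<lambda>e. \<exists>x\<in>elems V. Q x e)"
  using definable.neg[OF definable_all[OF definable.neg, of V Q]] by simp

text \<open>\<open>Q (t e) e\<close> says that some x equals \<open>t e\<close> and satisfies
  \<open>Q x e\<close>. So terms need no syntax of their own: a definable graph and values inside
  the universe suffice.\<close>

lemma definable_subst:
  assumes "definable V (\<lambda>e. Q (e 0) (\<lambda>i. e (Suc i)))" "definable_term V t"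
  shows "definable V (\<lambda>e. Q (t e) e)"
proof (rule definable.cong)
  show "definable V (\<lambda>e. \<exists>x\<in>elems V. x = t e \<and> Q x e)"
    using assms unfolding definable_term_def by (intro definable_ex definable.conj) auto
qed (use definable_term_elems[OF assms(2)] in auto)

lemma definable_term_rename:
  assumes "definable_term V t"
  shows "definable_term V (\<lambda>e. t (\<lambda>i. e (r i)))"
  unfolding definable_term_def
proof (intro conjI allI impI)
  show "definable V (\<lambda>e. e 0 = t (\<lambda>i. e (Suc (r i))))"
    using definable_rename[of V "\<lambda>e. e 0 = t (\<lambda>i. e (Suc i))" "case_nat 0 (\<lambda>i. Suc (r i))"] assms
    by (simp add: definable_term_def)
qed (rule definable_term_elems[OF assms], auto)

lemma definable_eq: "definable_term V s \<Longrightarrow> definable_term V t \<Longrightarrow> definable V (\<lambda>e. s e = t e)"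
  by (rule definable_subst[where Q="\<lambda>x e. x = t e"]) (simp_all add: definable_term_def)

lemma definable_mem:
  assumes "definable_term V s" "definable_term V t"
  shows "definable V (\<lambda>e. s e \<in> ext V (t e))"
proof (rule definable.cong)
  have "definable V (\<lambda>e. e 0 \<epsilon>\<^bsub>V\<^esub> t (\<lambda>i. e (Suc i)))"
    by (rule definable_subst[where Q="\<lambda>y e. e 0 \<epsilon>\<^bsub>V\<^esub> y"])
      (rule definable.mem_var definable_term_rename[OF assms(2)])+
  then show "definable V (\<lambda>e. s e \<epsilon>\<^bsub>V\<^esub> t e)"
    by (rule definable_subst[where Q="\<lambda>x e. x \<epsilon>\<^bsub>V\<^esub> t e"]) (rule assms)
qed (use definable_term_elems[OF assms(1)] in \<open>auto simp: ext_def\<close>)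

lemma definable_elems: "definable_term V s \<Longrightarrow> definable V (\<lambda>e. s e \<in> elems V)"
  by (rule definable.cong[OF definable_const[of V True]]) (simp add: definable_term_elems)

lemma definable_ball:
  assumes "definable_term V t" "definable V (\<lambda>e. Q (e 0) (\<lambda>i. e (Suc i)))"
  shows "definable V (\<lambda>e. \<forall>x\<in>ext V (t e). Q x e)"
proof (rule definable.cong)
  show "definable V (\<lambda>e. \<forall>x\<in>elems V. x \<in> ext V (t e) \<longrightarrow> Q x e)"
    by (intro definable_all definable_imp definable_mem definable_term_rename[OF assms(1)] assms(2))
      (auto simp: definable_term_def intro: definable.eq_var)
qed (auto simp: ext_def)

lemma definable_bex:
  assumes "definable_term V t" "definable V (\<lambda>e. Q (e 0) (\<lambda>i. e (Suc i)))"
  shows "definable V (\<lambda>e. \<exists>x\<in>ext V (t e). Q x e)"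
  using definable.neg[OF definable_ball[OF assms(1) definable.neg[OF assms(2)]]] by simp

lemma definable_term_var: "definable_term V (\<lambda>e. e i)"
  by (auto simp: definable_term_def intro: definable.eq_var)

lemma definable_term_parameter: "c \<in> elems V \<Longrightarrow> definable_term V (\<lambda>e. c)"
  using definable.parameter[OF definable.eq_var[of V "Suc 0" 0], of c]
  by (simp add: definable_term_def)

named_theorems definable_intros

lemmas [definable_intros] = definable_term_var definable_term_parameter
  definable_const definable.neg definable.conj definable_disj definable_imp definable_iff
  definable_elems definable_all definable_ex definable_ball definable_bex definable_eq definable_mem

lemma ext_subset_elems: "ext V x \<subseteq> elems V"
  by (auto simp: ext_def)

lemma ext_elems: "y \<in> ext V x \<Longrightarrow> y \<in> elems V"
  by (auto simp: ext_def)

section \<open>Sets and functions inside a model of ZFC\<close>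

definition upair :: "'a set_structure \<Rightarrow> 'a \<Rightarrow> 'a \<Rightarrow> 'a" where
  "upair V x y = the_set V {x, y}"

definition zero :: "'a set_structure \<Rightarrow> 'a" where
  "zero V = the_set V {}"

definition succ :: "'a set_structure \<Rightarrow> 'a \<Rightarrow> 'a" where
  "succ V x = the_set V (insert x (ext V x))"

text \<open>Totalizing application makes it a term that is definable for all arguments.\<close>

definition apply_in :: "'a set_structure \<Rightarrow> 'a \<Rightarrow> 'a \<Rightarrow> 'a" where
  "apply_in V f x =
     (if \<exists>!y. y \<in> elems V \<and> opair V x y \<in> ext V f then app V f x else zero V)"

definition triple :: "'a set_structure \<Rightarrow> 'a \<Rightarrow> 'a \<Rightarrow> 'a \<Rightarrow> 'a" where
  "triple V x y z = opair V x (opair V y z)"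

lemma opair_upair: "opair V x y = upair V (upair V x x) (upair V x y)"
  by (simp add: opair_def upair_def)

section \<open>The axioms as rules, and elementary set operations\<close>

locale zfc =
  fixes V :: "'a set_structure"
  assumes zfc_model: "zfc_model V"
begin

lemma extensionality: "x \<in> elems V \<Longrightarrow> y \<in> elems V \<Longrightarrow> ext V x = ext V y \<Longrightarrow> x = y"
  using zfc_model by (simp add: zfc_model_def)

lemma foundation: "x \<in> elems V \<Longrightarrow> ext V x \<noteq> {} \<Longrightarrow> \<exists>y\<in>ext V x. ext V y \<inter> ext V x = {}"
  using zfc_model by (simp add: zfc_model_def)

lemma is_set_pair: "x \<in> elems V \<Longrightarrow> y \<in> elems V \<Longrightarrow> is_set V {x, y}"
  using zfc_model by (simp add: zfc_model_def)

lemma is_set_Union: "x \<in> elems V \<Longrightarrow> is_set V (\<Union>y\<in>ext V x. ext V y)"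
  using zfc_model by (simp add: zfc_model_def)

lemma is_set_Pow: "x \<in> elems V \<Longrightarrow> is_set V {y \<in> elems V. ext V y \<subseteq> ext V x}"
  using zfc_model by (simp add: zfc_model_def)

lemma infinity: "\<exists>x. is_inductive V x"
  using zfc_model by (simp add: zfc_model_def)

lemma elems_nonempty: "elems V \<noteq> {}"
  using infinity by (auto simp: is_inductive_def)

lemma separation:
  assumes "x \<in> elems V" "definable V (\<lambda>e. P (e 0))"
  shows "is_set V {z \<in> ext V x. P z}"
proof -
  obtain \<phi> p where p: "range p \<subseteq> elems V"
    "\<And>e. range e \<subseteq> elems V \<Longrightarrow> P (e 0) = sat V (interleave e p) \<phi>"
    using definable_imp_fm[OF assms(2) elems_nonempty] by blast
  \<comment> \<open>\<open>P\<close> looks at position 0 only; \<open>x\<close> fills the rest of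
    the stack because the scheme wants an assignment into the universe.\<close>
  let ?a = "interleave (\<lambda>_. x) p"
  have "range ?a \<subseteq> elems V" using p(1) assms(1) by (intro range_interleave) auto
  moreover have "\<forall>\<phi> a. range a \<subseteq> elems V \<longrightarrow>
        (\<forall>x\<in>elems V. is_set V {z \<in> ext V x. sat V (a(0 := z)) \<phi>})"
    using zfc_model by (simp add: zfc_model_def)
  ultimately have "is_set V {z \<in> ext V x. sat V (?a(0 := z)) \<phi>}"
    using assms(1) by blast
  moreover have "sat V (?a(0 := z)) \<phi> \<longleftrightarrow> P z" if "z \<in> ext V x" for z
  proof -
    have *: "?a(0 := z) = interleave ((\<lambda>_. x)(0 := z)) p"
      by (auto simp: fun_eq_iff interleave_def)
    have "range ((\<lambda>_. x)(0 := z)) \<subseteq> elems V"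
      using that assms(1) by (auto simp: ext_elems)
    from p(2)[OF this] show ?thesis unfolding * fun_upd_same by (rule sym)
  qed
  ultimately show ?thesis by (simp cong: conj_cong Collect_cong)
qed

lemma the_set: "is_set V S \<Longrightarrow> the_set V S \<in> elems V \<and> ext V (the_set V S) = S"
  unfolding is_set_def the_set_def
  by (rule theI') (auto intro: extensionality)

lemma the_set_ext: "x \<in> elems V \<Longrightarrow> the_set V (ext V x) = x"
  using the_set[of "ext V x"] extensionality by (auto simp: is_set_def)

lemma is_setI: "x \<in> elems V \<Longrightarrow> is_set V (ext V x)"
  by (auto simp: is_set_def)

lemma is_set_mono:
  assumes "is_set V S" "definable V (\<lambda>e. P (e 0))" "\<And>z. z \<in> elems V \<Longrightarrow> P z \<Longrightarrow> z \<in> S"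
  shows "is_set V {z \<in> elems V. P z}"
proof -
  obtain x where x: "x \<in> elems V" "ext V x = S" using assms(1) by (auto simp: is_set_def)
  have "{z \<in> ext V x. P z} = {z \<in> elems V. P z}" using assms(3) x by (auto simp: ext_elems)
  with separation[OF x(1) assms(2)] show ?thesis by simp
qed

lemma upair: "x \<in> elems V \<Longrightarrow> y \<in> elems V \<Longrightarrow> upair V x y \<in> elems V \<and> ext V (upair V x y) = {x, y}"
  unfolding upair_def by (intro the_set is_set_pair)

lemma is_set_Un: "is_set V S \<Longrightarrow> is_set V T \<Longrightarrow> is_set V (S \<union> T)"
proof -
  assume "is_set V S" "is_set V T"
  then obtain x y where "x \<in> elems V" "ext V x = S" "y \<in> elems V" "ext V y = T"
    by (auto simp: is_set_def)
  then show ?thesis using is_set_Union[of "upair V x y"] upair[of x y] by simp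
qed

lemma is_set_empty: "is_set V {}"
  using elems_nonempty separation[OF _ definable_const, of _ False] by auto

lemma zero: "zero V \<in> elems V" "ext V (zero V) = {}"
  using the_set[OF is_set_empty] by (auto simp: zero_def)

lemma succ: "x \<in> elems V \<Longrightarrow> succ V x \<in> elems V \<and> ext V (succ V x) = insert x (ext V x)"
  unfolding succ_def
  using the_set[OF is_set_Un[OF is_set_pair[of x x] is_setI[of x]]] by simp

text \<open>By Extensionality, equality with the term unfolds to a statement about arbitrary members
  w. Thus operations introduced through \<open>the_set\<close> become definable as soon as their
  members are described.\<close>

lemma definable_term_ext:
  assumes "\<And>e. range e \<subseteq> elems V \<Longrightarrow> t e \<in> elems V \<and> ext V (t e) = {w \<in> elems V. Q w e}"
    and "definable V (\<lambda>e. Q (e 0) (\<lambda>i. e (Suc i)))"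
  shows "definable_term V t"
  unfolding definable_term_def
proof (intro conjI allI impI)
  show "definable V (\<lambda>e. e 0 = t (\<lambda>i. e (Suc i)))"
  proof (rule definable.cong)
    show "definable V (\<lambda>e. \<forall>w\<in>elems V. w \<in> ext V (e 0) \<longleftrightarrow> Q w (\<lambda>i. e (Suc i)))"
      \<comment> \<open>Below the quantifier, index 0 is w and index 1 the candidate value of the
        term, so the environment of \<open>Q\<close> is moved past the latter.\<close>
      using definable_rename[OF assms(2), of "case_nat 0 (\<lambda>i. Suc (Suc i))"]
      by (intro definable_intros) simp_all
    show "(\<forall>w\<in>elems V. w \<in> ext V (e 0) \<longleftrightarrow> Q w (\<lambda>i. e (Suc i))) \<longleftrightarrow> e 0 = t (\<lambda>i. e (Suc i))"
      if "range e \<subseteq> elems V" for e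
    proof -
      have "range (\<lambda>i. e (Suc i)) \<subseteq> elems V" "e 0 \<in> elems V" using that by auto
      with assms(1)[OF this(1)]
      have "e 0 = t (\<lambda>i. e (Suc i)) \<longleftrightarrow> ext V (e 0) = {w \<in> elems V. Q w (\<lambda>i. e (Suc i))}"
        by (metis extensionality)
      also have "\<dots> \<longleftrightarrow> (\<forall>w\<in>elems V. w \<in> ext V (e 0) \<longleftrightarrow> Q w (\<lambda>i. e (Suc i)))"
        using ext_subset_elems[of V "e 0"] by blast
      finally show ?thesis by simp
    qed
  qed
qed (use assms(1) in blast)

lemma definable_term_upair [definable_intros]:
  assumes "definable_term V s" "definable_term V t"
  shows "definable_term V (\<lambda>e. upair V (s e) (t e))"
  by (rule definable_term_ext[where Q="\<lambda>w e. w = s e \<or> w = t e"])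
    (use assms definable_term_elems[OF assms(1)] definable_term_elems[OF assms(2)] upair in
      \<open>auto intro!: definable_intros definable_term_rename[OF assms(1)] definable_term_rename[OF assms(2)]\<close>)

lemma definable_term_opair [definable_intros]:
  "definable_term V s \<Longrightarrow> definable_term V t \<Longrightarrow> definable_term V (\<lambda>e. opair V (s e) (t e))"
  unfolding opair_upair by (intro definable_intros)

lemma definable_term_triple [definable_intros]:
  "definable_term V s \<Longrightarrow> definable_term V t \<Longrightarrow> definable_term V u \<Longrightarrow>
    definable_term V (\<lambda>e. triple V (s e) (t e) (u e))"
  unfolding triple_def by (intro definable_intros)

lemma definable_term_zero [definable_intros]: "definable_term V (\<lambda>e. zero V)"
  by (intro definable_intros zero)

lemma definable_term_succ [definable_intros]:
  assumes "definable_term V s"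
  shows "definable_term V (\<lambda>e. succ V (s e))"
  by (rule definable_term_ext[where Q="\<lambda>w e. w = s e \<or> w \<in> ext V (s e)"])
    (use assms definable_term_elems[OF assms] succ in
      \<open>auto intro!: definable_intros definable_term_rename[OF assms] simp: ext_elems\<close>)

lemma opair_elems: "x \<in> elems V \<Longrightarrow> y \<in> elems V \<Longrightarrow> opair V x y \<in> elems V"
  by (simp add: opair_upair upair)

lemma opair_inject:
  assumes "x \<in> elems V" "y \<in> elems V" "x' \<in> elems V" "y' \<in> elems V"
  shows "opair V x y = opair V x' y' \<longleftrightarrow> x = x' \<and> y = y'"
proof
  have ext_opair: "ext V (opair V x y) = {upair V x x, upair V x y}"
    if "x \<in> elems V" "y \<in> elems V" for x y
    using that by (simp add: opair_upair upair)
  assume "opair V x y = opair V x' y'"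
  then have "{upair V x x, upair V x y} = {upair V x' x', upair V x' y'}"
    using ext_opair assms by metis
  \<comment> \<open>Passing to the extensions of the two members turns the Kuratowski pairs into HOL
    sets of the form {{x}, {x, y}}.\<close>
  then have "ext V ` {upair V x x, upair V x y} = ext V ` {upair V x' x', upair V x' y'}" by simp
  then show "x = x' \<and> y = y'" using assms by (auto simp: upair doubleton_eq_iff)
qed auto

lemma triple_elems: "x \<in> elems V \<Longrightarrow> y \<in> elems V \<Longrightarrow> z \<in> elems V \<Longrightarrow> triple V x y z \<in> elems V"
  by (simp add: triple_def opair_elems)

lemma triple_inject:
  assumes "x \<in> elems V" "y \<in> elems V" "z \<in> elems V" "x' \<in> elems V" "y' \<in> elems V" "z' \<in> elems V"
  shows "triple V x y z = triple V x' y' z' \<longleftrightarrow> x = x' \<and> y = y' \<and> z = z'"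
  using assms by (simp add: triple_def opair_inject opair_elems)

text \<open>Kuratowski pairs over \<open>S\<close> and \<open>T\<close> lie in the double power set
  of the union of \<open>S\<close> and \<open>T\<close>, from which Separation cuts out the
  product.\<close>

lemma is_set_Times:
  assumes "is_set V S" "is_set V T"
  shows "is_set V {opair V x y | x y. x \<in> S \<and> y \<in> T}"
proof -
  obtain a b where ab: "a \<in> elems V" "ext V a = S" "b \<in> elems V" "ext V b = T"
    using assms by (auto simp: is_set_def)
  obtain u where u: "u \<in> elems V" "ext V u = S \<union> T"
    using is_set_Un[OF assms] by (auto simp: is_set_def)
  obtain p where p: "p \<in> elems V" "ext V p = {y \<in> elems V. ext V y \<subseteq> S \<union> T}"
    using is_set_Pow[OF u(1)] u by (auto simp: is_set_def)
  have "is_set V {z \<in> elems V. \<exists>x\<in>ext V a. \<exists>y\<in>ext V b. z = opair V x y}"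
  proof (rule is_set_mono[OF is_set_Pow[OF p(1)]])
    show "definable V (\<lambda>e. \<exists>x\<in>ext V a. \<exists>y\<in>ext V b. e 0 = opair V x y)"
      by (intro definable_intros ab)
    fix z assume z: "z \<in> elems V" "\<exists>x\<in>ext V a. \<exists>y\<in>ext V b. z = opair V x y"
    then obtain x y where xy: "x \<in> S" "y \<in> T" "z = opair V x y" using ab by blast
    then have xy': "x \<in> elems V" "y \<in> elems V" using ab ext_elems by metis+
    have "ext V z \<subseteq> ext V p" using xy xy' p by (auto simp: opair_upair upair)
    then show "z \<in> {y \<in> elems V. ext V y \<subseteq> ext V p}" using z by simp
  qed
  moreover have "{z \<in> elems V. \<exists>x\<in>ext V a. \<exists>y\<in>ext V b. z = opair V x y} =
      {opair V x y | x y. x \<in> S \<and> y \<in> T}"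
    using ab ext_elems[of _ V a] ext_elems[of _ V b] opair_elems by auto
  ultimately show ?thesis by simp
qed

lemma apply_in_elems: "apply_in V f x \<in> elems V"
  using theI'[of "\<lambda>y. y \<in> elems V \<and> opair V x y \<in> ext V f"] zero(1)
  by (auto simp: apply_in_def app_def)

text \<open>Spells out the graph of application with quantifiers over the universe only, the form in
  which it is seen to be definable. The second disjunct is the default value at arguments without a
  unique value.\<close>

lemma apply_in_iff:
  assumes "y \<in> elems V"
  shows "y = apply_in V f x \<longleftrightarrow>
    opair V x y \<in> ext V f \<and> (\<forall>y'\<in>elems V. opair V x y' \<in> ext V f \<longrightarrow> y' = y) \<or>
    \<not> (\<exists>y\<in>elems V. opair V x y \<in> ext V f \<and> (\<forall>y'\<in>elems V. opair V x y' \<in> ext V f \<longrightarrow> y' = y)) \<and>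
    y = zero V"
proof (cases "\<exists>!y. y \<in> elems V \<and> opair V x y \<in> ext V f")
  case True
  then obtain z where z: "z \<in> elems V" "opair V x z \<in> ext V f"
    "\<And>y. y \<in> elems V \<Longrightarrow> opair V x y \<in> ext V f \<Longrightarrow> y = z" by blast
  have "apply_in V f x = z"
    unfolding apply_in_def app_def if_P[OF True] by (rule the1_equality[OF True]) (use z in blast)
  with z assms show ?thesis by metis
next
  case False
  then show ?thesis using assms by (auto simp: apply_in_def)
qed

lemma definable_term_apply_in [definable_intros]:
  assumes "definable_term V s" "definable_term V t"
  shows "definable_term V (\<lambda>e. apply_in V (s e) (t e))"
  unfolding definable_term_def
proof (intro conjI allI impI apply_in_elems)
  \<comment> \<open>\<open>s\<close> and \<open>t\<close> occur below zero, one or two quantifiers,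
    each time shifted once more by the candidate value at index 0.\<close>
  have *: "definable_term V (\<lambda>e. s (\<lambda>i. e (Suc i)))" "definable_term V (\<lambda>e. s (\<lambda>i. e (Suc (Suc i))))"
    "definable_term V (\<lambda>e. s (\<lambda>i. e (Suc (Suc (Suc i)))))"
    "definable_term V (\<lambda>e. t (\<lambda>i. e (Suc i)))" "definable_term V (\<lambda>e. t (\<lambda>i. e (Suc (Suc i))))"
    "definable_term V (\<lambda>e. t (\<lambda>i. e (Suc (Suc (Suc i)))))"
    by (rule definable_term_rename, rule assms)+
  show "definable V (\<lambda>e. e 0 = apply_in V (s (\<lambda>i. e (Suc i))) (t (\<lambda>i. e (Suc i))))"
    by (rule definable.cong[OF _ apply_in_iff[symmetric]]) (intro definable_intros *, auto)
qed

lemma apply_in_eq_app: "function_on V f a \<Longrightarrow> x \<in> ext V a \<Longrightarrow> apply_in V f x = app V f x"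
  by (simp add: function_on_def apply_in_def)

lemma function_on_app_iff:
  "function_on V f a \<Longrightarrow> x \<in> ext V a \<Longrightarrow> y \<in> elems V \<Longrightarrow> app V f x = y \<longleftrightarrow> opair V x y \<in> ext V f"
  using theI'[of "\<lambda>y. y \<in> elems V \<and> opair V x y \<in> ext V f"]
  unfolding function_on_def app_def by blast

lemma definable_function_on [definable_intros]:
  assumes "definable_term V s" "definable_term V t"
  shows "definable V (\<lambda>e. function_on V (s e) (t e))"
proof (rule definable.cong)
  note * = definable_term_rename[OF assms(1)] definable_term_rename[OF assms(2)]
  show "definable V (\<lambda>e.
     (\<forall>z\<in>ext V (s e). \<exists>x\<in>elems V. \<exists>y\<in>elems V. z = opair V x y \<and> x \<in> ext V (t e)) \<and>
     (\<forall>x\<in>ext V (t e). \<exists>y\<in>elems V. opair V x y \<in> ext V (s e) \<and>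
        (\<forall>y'\<in>elems V. opair V x y' \<in> ext V (s e) \<longrightarrow> y' = y)))"
    by (intro definable_intros assms *)
  fix e :: "nat \<Rightarrow> 'a" assume "range e \<subseteq> elems V"
  then have "s e \<in> elems V" by (rule definable_term_elems[OF assms(1)])
  moreover have "(\<forall>z\<in>ext V (s e). \<exists>x\<in>elems V. \<exists>y\<in>elems V. z = opair V x y \<and> x \<in> ext V (t e)) \<longleftrightarrow>
      ext V (s e) \<subseteq> {opair V x y |x y. x \<in> ext V (t e) \<and> y \<in> elems V}"
    using ext_subset_elems[of V "t e"] by blast
  moreover have "(\<exists>y\<in>elems V. P y \<and> (\<forall>y'\<in>elems V. P y' \<longrightarrow> y' = y)) \<longleftrightarrow>
      (\<exists>!y. y \<in> elems V \<and> P y)" for P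
    by blast
  ultimately show "(\<forall>z\<in>ext V (s e). \<exists>x\<in>elems V. \<exists>y\<in>elems V. z = opair V x y \<and> x \<in> ext V (t e)) \<and>
     (\<forall>x\<in>ext V (t e). \<exists>y\<in>elems V. opair V x y \<in> ext V (s e) \<and>
        (\<forall>y'\<in>elems V. opair V x y' \<in> ext V (s e) \<longrightarrow> y' = y)) \<longleftrightarrow> function_on V (s e) (t e)"
    by (simp add: function_on_def)
qed

text \<open>As the values are confined to the set \<open>b\<close>, the graph is separated from the
  product of \<open>a\<close> and \<open>b\<close>.\<close>

lemma function_exists:
  assumes a: "a \<in> elems V" and b: "b \<in> elems V" and R: "definable V (\<lambda>e. R (e 0) (e (Suc 0)))"
    and ex1: "\<And>x. x \<in> ext V a \<Longrightarrow> \<exists>!y. y \<in> ext V b \<and> R x y"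
  obtains f where "function_on V f a" "\<And>x. x \<in> ext V a \<Longrightarrow> app V f x \<in> ext V b \<and> R x (app V f x)"
proof -
  obtain p where p: "p \<in> elems V" "ext V p = {opair V x y | x y. x \<in> ext V a \<and> y \<in> ext V b}"
    using is_set_Times[OF is_setI[OF a] is_setI[OF b]] by (auto simp: is_set_def)
  have "is_set V {z \<in> ext V p. \<exists>x\<in>elems V. \<exists>y\<in>elems V. z = opair V x y \<and> R x y}"
  proof (rule separation[OF p(1)])
    show "definable V (\<lambda>e. \<exists>x\<in>elems V. \<exists>y\<in>elems V. e 0 = opair V x y \<and> R x y)"
      \<comment> \<open>Under the two quantifiers y has index 0 and x has index 1, so
        \<open>R\<close> is needed with its arguments swapped.\<close>
      using definable_rename[OF R, of "case_nat (Suc 0) (\<lambda>_. 0)"]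
      by (intro definable_intros) simp
  qed
  then obtain f where f: "f \<in> elems V"
    "ext V f = {z \<in> ext V p. \<exists>x\<in>elems V. \<exists>y\<in>elems V. z = opair V x y \<and> R x y}"
    by (auto simp: is_set_def)
  have pair: "opair V x y \<in> ext V f \<longleftrightarrow> y \<in> ext V b \<and> R x y"
    if "x \<in> ext V a" "y \<in> elems V" for x y
    using that unfolding f(2) p(2) by (auto simp: opair_inject ext_elems)
  have fun_f: "function_on V f a"
    unfolding function_on_def
  proof (intro conjI ballI f(1))
    show "ext V f \<subseteq> {opair V x y |x y. x \<in> ext V a \<and> y \<in> elems V}"
      unfolding f(2) p(2) by (auto dest: ext_elems)
    show "\<exists>!y. y \<in> elems V \<and> opair V x y \<in> ext V f" if "x \<in> ext V a" for x
      using ex1[OF that] pair[OF that] ext_elems by metis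
  qed
  moreover have "app V f x \<in> ext V b \<and> R x (app V f x)" if "x \<in> ext V a" for x
  proof -
    have "app V f x \<in> elems V"
      using apply_in_elems[of f x] apply_in_eq_app[OF fun_f that] by simp
    then show ?thesis using function_on_app_iff[OF fun_f that] pair[OF that] by blast
  qed
  ultimately show thesis by (rule that)
qed

end

section \<open>Inductive closures and the natural numbers of a model\<close>

text \<open>Transitive closure as the model sees it, used in place of recursion. HOL's closure would
  make only standardly many steps and miss nonstandard stages. If no set of the universe contains
  \<open>b\<close> and is closed under \<open>R\<close>, the condition holds vacuously; hence the
  closed set \<open>U\<close> in the rules below.\<close>

definition reach :: "'a set_structure \<Rightarrow> ('a \<Rightarrow> 'a \<Rightarrow> bool) \<Rightarrow> 'a \<Rightarrow> 'a \<Rightarrow> bool" where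
  "reach V R b u \<longleftrightarrow>
     (\<forall>A\<in>elems V. b \<in> ext V A \<and> (\<forall>x\<in>ext V A. \<forall>y\<in>elems V. R x y \<longrightarrow> y \<in> ext V A) \<longrightarrow>
        u \<in> ext V A)"

lemma reach_refl: "reach V R b b"
  by (simp add: reach_def)

lemma reach_step: "reach V R b x \<Longrightarrow> R x y \<Longrightarrow> y \<in> elems V \<Longrightarrow> reach V R b y"
  unfolding reach_def by blast

lemma reach_step_left: "R b c \<Longrightarrow> c \<in> elems V \<Longrightarrow> reach V R c u \<Longrightarrow> reach V R b u"
  unfolding reach_def by blast

lemma definable_relation:
  assumes "definable V (\<lambda>e. R (e 0) (e (Suc 0)))" "definable_term V s" "definable_term V t"
  shows "definable V (\<lambda>e. R (s e) (t e))"
proof (rule definable_subst[where Q="\<lambda>x e. R x (t e)", OF _ assms(2)])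
  show "definable V (\<lambda>e. R (e 0) (t (\<lambda>i. e (Suc i))))"
  proof (rule definable_subst[where Q="\<lambda>y e. R (e 0) y", OF _ definable_term_rename[OF assms(3)]])
    show "definable V (\<lambda>e. R (e (Suc 0)) (e 0))"
      using definable_rename[OF assms(1), of "case_nat (Suc 0) (\<lambda>_. 0)"] by simp
  qed
qed

text \<open>The sets \<open>A\<close> in the definition are objects of the universe, so reachability
  stays first order and may itself occur in inductions and separations.\<close>

lemma definable_reach:
  assumes "definable V (\<lambda>e. R (e 0) (e (Suc 0)))" "definable_term V s" "definable_term V t"
  shows "definable V (\<lambda>e. reach V R (s e) (t e))"
  unfolding reach_def
  by (intro definable_intros definable_relation[OF assms(1)]
      definable_term_rename[OF assms(2)] definable_term_rename[OF assms(3)])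

context zfc
begin

abbreviation naturals ("\<omega>") where "\<omega> \<equiv> ext V (omega V)"

text \<open>The elements of \<open>U\<close> with property \<open>P\<close> form, by Separation, one
  of the closed sets over which \<open>reach\<close> quantifies. Only definable \<open>P\<close> are
  therefore admissible.\<close>

lemma reach_induct [consumes 1, case_names elems closed start definable refl step]:
  assumes reach: "reach V R b u" and U: "U \<in> elems V"
    and closed: "\<And>x y. x \<in> ext V U \<Longrightarrow> y \<in> elems V \<Longrightarrow> R x y \<Longrightarrow> y \<in> ext V U"
    and b: "b \<in> ext V U" and P: "definable V (\<lambda>e. P (e 0))" and "P b"
    and step: "\<And>x y. x \<in> ext V U \<Longrightarrow> y \<in> ext V U \<Longrightarrow> P x \<Longrightarrow> R x y \<Longrightarrow> P y"
  shows "P u"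
proof -
  obtain A where A: "A \<in> elems V" "ext V A = {z \<in> ext V U. P z}"
    using separation[OF U P] by (auto simp: is_set_def)
  have "u \<in> ext V A"
  proof (rule reach[unfolded reach_def, rule_format, OF A(1)], intro conjI ballI impI)
    show "b \<in> ext V A" using A(2) b \<open>P b\<close> by simp
    fix x y assume "x \<in> ext V A" "y \<in> elems V" "R x y"
    then show "y \<in> ext V A" using closed[of x y] step[of x y] unfolding A(2) by blast
  qed
  then show ?thesis using A(2) by simp
qed

text \<open>Induction lengthens a path at its far end, while the first step is wanted here: it is
  inherited from the path to x, unless that path is trivial, in which case y itself is the first
  step.\<close>

lemma reach_left_cases:
  assumes "reach V R b u" "definable V (\<lambda>e. R (e 0) (e (Suc 0)))" and U: "U \<in> elems V"
    and closed: "\<And>x y. x \<in> ext V U \<Longrightarrow> y \<in> elems V \<Longrightarrow> R x y \<Longrightarrow> y \<in> ext V U"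
    and b: "b \<in> ext V U"
  shows "u = b \<or> (\<exists>c\<in>ext V U. R b c \<and> reach V R c u)"
  using assms(1)
proof (induction rule: reach_induct[where U=U])
  case definable
  show ?case
    by (intro definable_intros definable_relation[OF assms(2)] definable_reach[OF assms(2)] U ext_elems[OF b])
next
  case (step x y)
  then show ?case using reach_refl reach_step ext_elems by metis
qed (use U closed b in auto)

text \<open>The last step into y comes from x. That x is reachable is not part of the induction
  step, so it is recovered from the induction hypothesis.\<close>

lemma reach_right_cases:
  assumes "reach V R b u" "definable V (\<lambda>e. R (e 0) (e (Suc 0)))" and U: "U \<in> elems V"
    and closed: "\<And>x y. x \<in> ext V U \<Longrightarrow> y \<in> elems V \<Longrightarrow> R x y \<Longrightarrow> y \<in> ext V U"
    and b: "b \<in> ext V U"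
  shows "u = b \<or> (\<exists>c\<in>ext V U. reach V R b c \<and> R c u)"
  using assms(1)
proof (induction rule: reach_induct[where U=U])
  case definable
  show ?case
    by (intro definable_intros definable_relation[OF assms(2)] definable_reach[OF assms(2)] U ext_elems[OF b])
next
  case (step x y)
  then show ?case using reach_refl reach_step ext_elems by metis
qed (use U closed b in auto)

section \<open>The natural numbers of the model\<close>

lemma is_inductive_iff:
  "is_inductive V x \<longleftrightarrow>
     x \<in> elems V \<and> zero V \<in> ext V x \<and> (\<forall>y\<in>ext V x. succ V y \<in> ext V x)"
proof -
  have "(\<exists>e\<in>ext V x. ext V e = {}) \<longleftrightarrow> zero V \<in> ext V x"
    using zero extensionality ext_elems by metis
  moreover have "(\<exists>s\<in>ext V x. ext V s = insert y (ext V y)) \<longleftrightarrow> succ V y \<in> ext V x"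
    if "y \<in> elems V" for y
    using succ[OF that] extensionality ext_elems by metis
  ultimately show ?thesis unfolding is_inductive_def using ext_elems[of _ V x] by blast
qed

lemma omega:
  "omega V \<in> elems V"
  "\<omega> = {n \<in> elems V. \<forall>x. is_inductive V x \<longrightarrow> n \<in> ext V x}"
proof -
  obtain I where I: "is_inductive V I" using infinity by blast
  \<comment> \<open>Restricting the quantifier to the universe and expressing inductiveness by
    \<open>zero\<close> and \<open>succ\<close> makes the defining condition definable.\<close>
  have eq: "{n \<in> elems V. \<forall>x. is_inductive V x \<longrightarrow> n \<in> ext V x} = {n \<in> elems V. \<forall>x\<in>elems V.
      zero V \<in> ext V x \<and> (\<forall>y\<in>ext V x. succ V y \<in> ext V x) \<longrightarrow> n \<in> ext V x}"
    unfolding is_inductive_iff by blast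
  have "is_set V {n \<in> elems V. \<forall>x. is_inductive V x \<longrightarrow> n \<in> ext V x}"
    unfolding eq
  proof (rule is_set_mono[OF is_setI])
    show "I \<in> elems V" using I by (simp add: is_inductive_def)
    show "definable V (\<lambda>e. \<forall>x\<in>elems V.
      zero V \<in> ext V x \<and> (\<forall>y\<in>ext V x. succ V y \<in> ext V x) \<longrightarrow> e 0 \<in> ext V x)"
      by (intro definable_intros zero)
  qed (use I in \<open>auto simp: is_inductive_iff\<close>)
  from the_set[OF this] show "omega V \<in> elems V"
    "\<omega> = {n \<in> elems V. \<forall>x. is_inductive V x \<longrightarrow> n \<in> ext V x}"
    by (auto simp: omega_def)
qed

lemma zero_nat: "zero V \<in> \<omega>"
  using zero(1) by (auto simp: omega(2) is_inductive_iff)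

lemma succ_nat: "n \<in> \<omega> \<Longrightarrow> succ V n \<in> \<omega>"
  using succ by (auto simp: omega(2) is_inductive_iff)

lemma nat_elems: "n \<in> \<omega> \<Longrightarrow> n \<in> elems V"
  by (rule ext_elems)

lemma ext_succ: "n \<in> elems V \<Longrightarrow> ext V (succ V n) = insert n (ext V n)"
  by (simp add: succ)

text \<open>The numbers satisfying \<open>P\<close> form an inductive set. Definability of
  \<open>P\<close> is essential: the standard numbers of an ill-founded model are closed under
  successor without exhausting its omega.\<close>

lemma nat_induct [consumes 1, case_names definable base step]:
  assumes "n \<in> \<omega>" "definable V (\<lambda>e. P (e 0))" "P (zero V)"
    "\<And>n. n \<in> \<omega> \<Longrightarrow> P n \<Longrightarrow> P (succ V n)"
  shows "P n"
proof -
  obtain A where A: "A \<in> elems V" "ext V A = {z \<in> \<omega>. P z}"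
    using separation[OF omega(1) assms(2)] by (auto simp: is_set_def)
  have "is_inductive V A"
    using A assms zero_nat succ_nat by (simp add: is_inductive_iff)
  then have "n \<in> ext V A" using assms(1) omega(2) by auto
  then show ?thesis using A(2) by simp
qed

lemma nat_less_nat: "n \<in> \<omega> \<Longrightarrow> m \<in> ext V n \<Longrightarrow> m \<in> \<omega>"
proof -
  assume "n \<in> \<omega>"
  then have "\<forall>m\<in>ext V n. m \<in> \<omega>"
  proof (induction rule: nat_induct)
    case definable show ?case by (intro definable_intros omega)
  qed (auto simp: zero ext_succ nat_elems)
  then show "m \<in> ext V n \<Longrightarrow> m \<in> \<omega>" by blast
qed

lemma nat_less_trans: "n \<in> \<omega> \<Longrightarrow> m \<in> ext V n \<Longrightarrow> k \<in> ext V m \<Longrightarrow> k \<in> ext V n"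
proof -
  assume "n \<in> \<omega>"
  then have "\<forall>m\<in>ext V n. \<forall>k\<in>ext V m. k \<in> ext V n"
  proof (induction rule: nat_induct)
    case definable show ?case by (intro definable_intros)
  qed (auto simp: zero ext_succ nat_elems)
  then show "m \<in> ext V n \<Longrightarrow> k \<in> ext V m \<Longrightarrow> k \<in> ext V n" by blast
qed

text \<open>Foundation applied to the singleton of \<open>x\<close>.\<close>

lemma mem_irrefl: "x \<notin> ext V x"
proof
  assume x: "x \<in> ext V x"
  then have "x \<in> elems V" by (rule ext_elems)
  with foundation[of "upair V x x"] upair[of x x] x show False by auto
qed

lemma nat_less_asym: "n \<in> \<omega> \<Longrightarrow> m \<in> ext V n \<Longrightarrow> n \<notin> ext V m"
  using nat_less_trans mem_irrefl by blast

lemma nat_zero_or_pos: "n \<in> \<omega> \<Longrightarrow> n = zero V \<or> zero V \<in> ext V n"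
proof (induction rule: nat_induct)
  case definable show ?case by (intro definable_intros)
qed (auto simp: ext_succ nat_elems)

lemma succ_le: "n \<in> \<omega> \<Longrightarrow> m \<in> ext V n \<Longrightarrow> succ V m = n \<or> succ V m \<in> ext V n"
proof -
  assume "n \<in> \<omega>"
  then have "\<forall>m\<in>ext V n. succ V m = n \<or> succ V m \<in> ext V n"
  proof (induction rule: nat_induct)
    case definable show ?case by (intro definable_intros)
  qed (auto simp: zero ext_succ nat_elems)
  then show "m \<in> ext V n \<Longrightarrow> succ V m = n \<or> succ V m \<in> ext V n" by blast
qed

lemma nat_linear: "n \<in> \<omega> \<Longrightarrow> m \<in> \<omega> \<Longrightarrow> m \<in> ext V n \<or> m = n \<or> n \<in> ext V m"
proof -
  assume "n \<in> \<omega>"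
  then have "\<forall>m\<in>\<omega>. m \<in> ext V n \<or> m = n \<or> n \<in> ext V m"
  proof (induction rule: nat_induct)
    case definable show ?case by (intro definable_intros omega)
  next
    case base show ?case using nat_zero_or_pos by blast
  next
    case (step n) then show ?case using succ_le by (auto simp: ext_succ nat_elems)
  qed
  then show "m \<in> \<omega> \<Longrightarrow> m \<in> ext V n \<or> m = n \<or> n \<in> ext V m" by blast
qed

lemma nat_cases: "n \<in> \<omega> \<Longrightarrow> n = zero V \<or> (\<exists>m\<in>\<omega>. n = succ V m)"
proof (induction rule: nat_induct)
  case definable show ?case by (intro definable_intros omega)
qed auto

lemma succ_inject: "m \<in> \<omega> \<Longrightarrow> n \<in> \<omega> \<Longrightarrow> succ V m = succ V n \<Longrightarrow> m = n"
  by (metis ext_succ insert_iff nat_elems nat_less_asym)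

lemma nat_upper_bound: "m \<in> \<omega> \<Longrightarrow> n \<in> \<omega> \<Longrightarrow> \<exists>k\<in>\<omega>. m \<in> ext V k \<and> n \<in> ext V k"
  using nat_linear[of n m] succ_nat[of n] succ_nat[of m] ext_succ[of n] ext_succ[of m] nat_elems
  by (metis insertCI)

text \<open>The order is membership, so a minimal element in the sense of Foundation of the set of
  all n with \<open>P n\<close> is a least one.\<close>

lemma nat_least:
  assumes "n \<in> \<omega>" "P n" "definable V (\<lambda>e. P (e 0))"
  shows "\<exists>n\<in>\<omega>. P n \<and> (\<forall>m\<in>ext V n. \<not> P m)"
proof -
  obtain A where A: "A \<in> elems V" "ext V A = {z \<in> \<omega>. P z}"
    using separation[OF omega(1) assms(3)] by (auto simp: is_set_def)
  then obtain k where "k \<in> ext V A" "ext V k \<inter> ext V A = {}"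
    using foundation[of A] assms by auto
  with A nat_less_nat show ?thesis by blast
qed

lemma nat_less_induct [consumes 1, case_names definable less]:
  assumes "n \<in> \<omega>" "definable V (\<lambda>e. P (e 0))"
    "\<And>n. n \<in> \<omega> \<Longrightarrow> (\<And>m. m \<in> ext V n \<Longrightarrow> P m) \<Longrightarrow> P n"
  shows "P n"
  using nat_least[of n "\<lambda>n. \<not> P n"] assms definable.neg by blast

text \<open>An enumeration \<open>g\<close> on \<open>n\<close> is bounded on each initial segment
  \<open>k\<close>, by induction on \<open>k\<close>. The guard by \<open>n\<close> is there because
  \<open>k\<close> runs through all of omega; in the end \<open>k\<close> is
  \<open>n\<close>.\<close>

lemma finite_in_imp_bounded:
  assumes "finite_in V S" "S \<subseteq> \<omega>"
  shows "\<exists>m\<in>\<omega>. S \<subseteq> ext V m"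
proof -
  obtain n g where n: "n \<in> \<omega>" and g: "function_on V g n" "bij_betw (app V g) (ext V n) S"
    using assms(1) by (auto simp: finite_in_def)
  have "g \<in> elems V" using g(1) by (simp add: function_on_def)
  have "\<exists>m\<in>\<omega>. \<forall>i\<in>ext V k. i \<in> ext V n \<longrightarrow> apply_in V g i \<in> ext V m" if "k \<in> \<omega>" for k
    using that
  proof (induction rule: nat_induct)
    case definable
    show ?case by (intro definable_intros omega \<open>g \<in> elems V\<close> nat_elems[OF n])
  next
    case base then show ?case using zero_nat by (auto simp: zero)
  next
    case (step k)
    then obtain m where m: "m \<in> \<omega>" "\<forall>i\<in>ext V k. i \<in> ext V n \<longrightarrow> apply_in V g i \<in> ext V m" by blast
    show ?case
    proof (cases "k \<in> ext V n")
      case True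
      then have "apply_in V g k \<in> \<omega>"
        using g assms(2) by (auto simp: apply_in_eq_app bij_betw_def)
      then obtain m' where m': "m' \<in> \<omega>" "m \<in> ext V m'" "apply_in V g k \<in> ext V m'"
        using nat_upper_bound m(1) by blast
      then show ?thesis using m step(1) nat_less_trans[OF m'(1,2)]
        by (intro bexI[of _ m']) (auto simp: ext_succ nat_elems)
    next
      case False
      with m step(1) show ?thesis by (intro bexI[of _ m]) (auto simp: ext_succ nat_elems)
    qed
  qed
  then obtain m where "m \<in> \<omega>" "\<forall>i\<in>ext V n. apply_in V g i \<in> ext V m" using n by blast
  moreover have "S = app V g ` ext V n" using g(2) by (simp add: bij_betw_def)
  ultimately show ?thesis using apply_in_eq_app[OF g(1)] by (intro bexI[of _ m]) auto
qed

text \<open>By induction on \<open>k\<close>, the part of \<open>S\<close> below \<open>k\<close>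
  has an enumeration inside the model. \<open>?P k n g\<close> says in first-order form that
  \<open>g\<close> maps \<open>n\<close> bijectively onto that part. An external bounded class would
  not do, which is why \<open>S\<close> must be a set of the model.\<close>

lemma bounded_imp_finite_in:
  assumes "is_set V S" "m \<in> \<omega>" "S \<subseteq> ext V m"
  shows "finite_in V S"
proof -
  obtain A where A: "A \<in> elems V" "ext V A = S" using assms(1) by (auto simp: is_set_def)
  let ?P = "\<lambda>k n g. function_on V g n \<and>
    (\<forall>i\<in>ext V n. apply_in V g i \<in> ext V A \<and> apply_in V g i \<in> ext V k) \<and>
    (\<forall>i\<in>ext V n. \<forall>j\<in>ext V n. apply_in V g i = apply_in V g j \<longrightarrow> i = j) \<and>
    (\<forall>y\<in>ext V A. y \<in> ext V k \<longrightarrow> (\<exists>i\<in>ext V n. apply_in V g i = y))"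
  have "\<exists>n\<in>\<omega>. \<exists>g\<in>elems V. ?P k n g" if "k \<in> \<omega>" for k
    using that
  proof (induction rule: nat_induct)
    case definable
    show ?case by (intro definable_intros omega A(1))
  next
    case base
    have "function_on V (zero V) (zero V)" by (simp add: function_on_def zero)
    then show ?case using zero zero_nat by (intro bexI[of _ "zero V"]) auto
  next
    case (step k)
    then obtain n g where n: "n \<in> \<omega>" and g: "g \<in> elems V" and P: "?P k n g" by blast
    have k: "ext V (succ V k) = insert k (ext V k)" using step(1) by (simp add: ext_succ nat_elems)
    show ?case
    proof (cases "k \<in> ext V A")
      case False
      with n g P k show ?thesis by (intro bexI[of _ n] bexI[of _ g]) auto
    next
      case True
      have n': "ext V (succ V n) = insert n (ext V n)" using n by (simp add: ext_succ nat_elems)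
      \<comment> \<open>The new element \<open>k\<close> is listed last, at index \<open>n\<close>;
        earlier values are kept.\<close>
      let ?R = "\<lambda>i y. i \<in> ext V n \<and> y = apply_in V g i \<or> i = n \<and> y = k"
      have R: "definable V (\<lambda>e. ?R (e 0) (e (Suc 0)))"
        by (intro definable_intros nat_elems[OF n] nat_elems[OF step(1)] g)
      have ex1: "\<exists>!y. y \<in> ext V A \<and> ?R i y" if "i \<in> ext V (succ V n)" for i
      proof (cases "i = n")
        case True
        then show ?thesis using mem_irrefl[of n] \<open>k \<in> ext V A\<close> by auto
      next
        case False
        then have "i \<in> ext V n" using that n' by simp
        then show ?thesis using P False by auto
      qed
      obtain g' where g': "function_on V g' (succ V n)"
        "\<And>i. i \<in> ext V (succ V n) \<Longrightarrow> app V g' i \<in> ext V A \<and> ?R i (app V g' i)"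
        using function_exists[OF nat_elems[OF succ_nat[OF n]] A(1) R ex1] by blast
      have old: "apply_in V g' i = apply_in V g i" if "i \<in> ext V n" for i
        using g' that n' mem_irrefl[of n] by (auto simp: apply_in_eq_app)
      have new: "apply_in V g' n = k"
        using g' n' mem_irrefl[of n] by (auto simp: apply_in_eq_app)
      have "apply_in V g i \<noteq> k" if "i \<in> ext V n" for i
        using P that mem_irrefl[of k] by auto
      then have "?P (succ V k) (succ V n) g'"
        unfolding k n' using g'(1) old new P True by (auto simp: n')
      moreover have "g' \<in> elems V" using g'(1) by (simp add: function_on_def)
      ultimately show ?thesis using succ_nat[OF n] by blast
    qed
  qed
  then obtain n g where n: "n \<in> \<omega>" and P: "?P m n g" using assms(2) by blast
  then have "bij_betw (app V g) (ext V n) S"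
    using A(2) assms(3) apply_in_eq_app[of g n] by (auto simp: bij_betw_def inj_on_def)
  with n P assms(1) show ?thesis by (auto simp: finite_in_def)
qed

end

section \<open>The labelled tree\<close>

context zfc
begin

lemma is_set_triples: "is_set V {triple V x y z | x y z. x \<in> \<omega> \<and> y \<in> \<omega> \<and> z \<in> \<omega>}"
proof -
  have "is_set V {opair V x w | x w. x \<in> \<omega> \<and> w \<in> {opair V y z | y z. y \<in> \<omega> \<and> z \<in> \<omega>}}"
    by (intro is_set_Times is_setI omega)
  moreover have "{opair V x w | x w. x \<in> \<omega> \<and> w \<in> {opair V y z | y z. y \<in> \<omega> \<and> z \<in> \<omega>}} =
      {triple V x y z | x y z. x \<in> \<omega> \<and> y \<in> \<omega> \<and> z \<in> \<omega>}"
    unfolding triple_def by blast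
  ultimately show ?thesis by simp
qed

lemma nat_triple_inject:
  "x \<in> \<omega> \<Longrightarrow> y \<in> \<omega> \<Longrightarrow> z \<in> \<omega> \<Longrightarrow> x' \<in> \<omega> \<Longrightarrow> y' \<in> \<omega> \<Longrightarrow> z' \<in> \<omega> \<Longrightarrow>
    triple V x y z = triple V x' y' z' \<longleftrightarrow> x = x' \<and> y = y' \<and> z = z'"
  by (simp add: triple_inject nat_elems)

text \<open>
  \<open>triple V s b t\<close> in \<open>E\<close> means that \<open>t\<close> is a child of \<open>s\<close> with label \<open>b\<close>, and in \<open>D\<close> that \<open>t\<close> lies
  at or above such a child. The child is the position of \<open>(s, b)\<close> in the lexicographic list of
  all pairs with \<open>b < h s\<close>; starting that list at 1 makes each child larger than its parent.
\<close>

lemma labelled_tree: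
  assumes h: "h \<in> elems V" "\<And>n. n \<in> \<omega> \<Longrightarrow> apply_in V h n \<in> \<omega>"
    and pos: "\<And>n. n \<in> \<omega> \<Longrightarrow> zero V \<in> ext V (apply_in V h n)"
  obtains E D where "E \<in> elems V" "D \<in> elems V"
    "\<And>s b. s \<in> \<omega> \<Longrightarrow> b \<in> ext V (apply_in V h s) \<Longrightarrow> \<exists>t\<in>\<omega>. triple V s b t \<in> ext V E"
    "\<And>s b t. s \<in> \<omega> \<Longrightarrow> b \<in> \<omega> \<Longrightarrow> t \<in> \<omega> \<Longrightarrow> triple V s b t \<in> ext V E \<Longrightarrow> s \<in> ext V t"
    "\<And>s b t. s \<in> \<omega> \<Longrightarrow> b \<in> \<omega> \<Longrightarrow> t \<in> \<omega> \<Longrightarrow> triple V s b t \<in> ext V E \<Longrightarrow> triple V s b t \<in> ext V D"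
    "\<And>r c s b t. r \<in> \<omega> \<Longrightarrow> c \<in> \<omega> \<Longrightarrow> s \<in> \<omega> \<Longrightarrow> b \<in> \<omega> \<Longrightarrow> t \<in> \<omega> \<Longrightarrow>
      triple V r c t \<in> ext V E \<Longrightarrow> triple V s b r \<in> ext V D \<Longrightarrow> triple V s b t \<in> ext V D"
    "\<And>s b b' t. s \<in> \<omega> \<Longrightarrow> b \<in> \<omega> \<Longrightarrow> b' \<in> \<omega> \<Longrightarrow> t \<in> \<omega> \<Longrightarrow>
      triple V s b t \<in> ext V D \<Longrightarrow> triple V s b' t \<in> ext V D \<Longrightarrow> b = b'"
proof -
  \<comment> \<open>Successor in the lexicographic list: the next label of row a if it is below h a,
    otherwise label 0 of the next row.\<close>
  let ?next = "\<lambda>a b a' b'. succ V b \<in> ext V (apply_in V h a) \<and> a' = a \<and> b' = succ V b \<or>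
    succ V b \<notin> ext V (apply_in V h a) \<and> a' = succ V a \<and> b' = zero V"
  \<comment> \<open>Here triples are ordered as position, row, label, unlike those in
    \<open>E\<close> and \<open>D\<close>. Running through them by a relation replaces a recursion
    on the position.\<close>
  define R where "R z z' \<longleftrightarrow> (\<exists>t\<in>\<omega>. \<exists>a\<in>\<omega>. \<exists>b\<in>\<omega>. \<exists>a'\<in>\<omega>. \<exists>b'\<in>\<omega>.
      z = triple V t a b \<and> ?next a b a' b' \<and> z' = triple V (succ V t) a' b')" for z z'
  define start where "start = triple V (succ V (zero V)) (zero V) (zero V)"
  define Q where "Q t a b \<longleftrightarrow> reach V R start (triple V t a b)" for t a b
  obtain U where U: "U \<in> elems V"
    "ext V U = {triple V x y z | x y z. x \<in> \<omega> \<and> y \<in> \<omega> \<and> z \<in> \<omega>}"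
    using is_set_triples by (auto simp: is_set_def)
  have R: "definable V (\<lambda>e. R (e 0) (e (Suc 0)))"
    unfolding R_def by (intro definable_intros omega h)
  have start: "start \<in> ext V U"
    unfolding start_def U(2) using zero_nat succ_nat by blast
  have R_closed: "y \<in> ext V U" if "R x y" for x y
    using that unfolding R_def U(2) using succ_nat by blast
  have Q_definable: "definable V (\<lambda>e. reach V R start (t e))" if "definable_term V t" for t
    by (intro definable_reach R definable_intros that ext_elems[OF start])
  have Q_start: "Q (succ V (zero V)) (zero V) (zero V)"
    by (simp add: Q_def start_def[symmetric] reach_refl)
  have Q_step: "Q (succ V t) a' b'" if "Q t a b" "t \<in> \<omega>" "a \<in> \<omega>" "b \<in> \<omega>" "a' \<in> \<omega>" "b' \<in> \<omega>"
    "?next a b a' b'" for t a b a' b'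
    unfolding Q_def
  proof (rule reach_step)
    show "reach V R start (triple V t a b)" using that(1) by (simp add: Q_def)
    show "R (triple V t a b) (triple V (succ V t) a' b')"
      unfolding R_def using that by blast
    show "triple V (succ V t) a' b' \<in> elems V"
      using that by (intro triple_elems nat_elems succ_nat)
  qed
  have Q_bounds: "a \<in> ext V t \<and> b \<in> ext V (apply_in V h a)"
    if "Q t a b" "t \<in> \<omega>" "a \<in> \<omega>" "b \<in> \<omega>" for t a b
  proof -
    \<comment> \<open>The induction runs over coded triples, the invariant concerns their
      coordinates; hence the decoding, undone later by injectivity. The row stays below the position
      because it grows by at most one per step.\<close>
    have "\<exists>t'\<in>\<omega>. \<exists>a'\<in>\<omega>. \<exists>b'\<in>\<omega>. triple V t a b = triple V t' a' b' \<and>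
        a' \<in> ext V t' \<and> b' \<in> ext V (apply_in V h a')"
      using that(1) unfolding Q_def
    proof (induction rule: reach_induct[where U=U])
      case definable
      show ?case by (intro definable_intros omega h)
    next
      case refl
      have "zero V \<in> ext V (succ V (zero V))" using ext_succ zero(1) by simp
      then show ?case unfolding start_def using zero_nat succ_nat pos by blast
    next
      case (step x y)
      then obtain t a b a' b' where *: "t \<in> \<omega>" "a \<in> \<omega>" "b \<in> \<omega>" "a' \<in> \<omega>" "b' \<in> \<omega>"
        "x = triple V t a b" "?next a b a' b'" "y = triple V (succ V t) a' b'"
        unfolding R_def by blast
      then have a: "a \<in> ext V t" using step.IH by (auto simp: nat_triple_inject)
      have "a' \<in> ext V (succ V t)"
        using *(7) a succ_le[OF *(1) a] *(1) by (auto simp: ext_succ nat_elems)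
      moreover have "b' \<in> ext V (apply_in V h a')" using *(7) pos *(4) by auto
      ultimately show ?case using * succ_nat by blast
    qed (use U start R_closed in auto)
    then show ?thesis using that by (auto simp: nat_triple_inject)
  qed
  have Q_cases: "t = succ V (zero V) \<and> a = zero V \<and> b = zero V \<or>
      (\<exists>t'\<in>\<omega>. \<exists>a'\<in>\<omega>. \<exists>b'\<in>\<omega>. Q t' a' b' \<and> t = succ V t' \<and> ?next a' b' a b)"
    if "Q t a b" "t \<in> \<omega>" "a \<in> \<omega>" "b \<in> \<omega>" for t a b
  proof -
    have "triple V t a b = start \<or>
        (\<exists>c\<in>ext V U. reach V R start c \<and> R c (triple V t a b))"
      by (rule reach_right_cases[OF that(1)[unfolded Q_def] R U(1) _ start]) (rule R_closed)
    then show ?thesis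
    proof (elim disjE bexE conjE)
      assume "triple V t a b = start"
      then show ?thesis unfolding start_def using that zero_nat succ_nat nat_triple_inject by auto
    next
      fix c assume c: "reach V R start c" "R c (triple V t a b)"
      then obtain t' a' b' a'' b'' where *: "t' \<in> \<omega>" "a' \<in> \<omega>" "b' \<in> \<omega>" "a'' \<in> \<omega>" "b'' \<in> \<omega>"
        "c = triple V t' a' b'" "?next a' b' a'' b''" "triple V t a b = triple V (succ V t') a'' b''"
        unfolding R_def by blast
      then have "t = succ V t'" "a = a''" "b = b''"
        using that succ_nat by (auto simp: nat_triple_inject)
      then show ?thesis using * c(1) unfolding Q_def by blast
    qed
  qed
  have Q_fun: "a = a' \<and> b = b'" if "Q t a b" "Q t a' b'"
    "t \<in> \<omega>" "a \<in> \<omega>" "b \<in> \<omega>" "a' \<in> \<omega>" "b' \<in> \<omega>" for t a b a' b'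
  proof -
    \<comment> \<open>Position 0 is empty, as its row would be a member of 0. So position 1 can only
      be the start of the list.\<close>
    have not0: "\<not> Q (zero V) a b" if "a \<in> \<omega>" "b \<in> \<omega>" for a b
      using Q_bounds[OF _ zero_nat that] zero by auto
    have "\<forall>a\<in>\<omega>. \<forall>b\<in>\<omega>. \<forall>a'\<in>\<omega>. \<forall>b'\<in>\<omega>. Q t a b \<longrightarrow> Q t a' b' \<longrightarrow> a = a' \<and> b = b'"
      using \<open>t \<in> \<omega>\<close>
    proof (induction rule: nat_induct)
      case definable show ?case unfolding Q_def by (intro definable_intros Q_definable omega)
    next
      case base show ?case using not0 by blast
    next
      case (step t)
      have *: "t = zero V \<and> a = zero V \<and> b = zero V \<or>
          (\<exists>a'\<in>\<omega>. \<exists>b'\<in>\<omega>. Q t a' b' \<and> ?next a' b' a b)"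
        if "Q (succ V t) a b" "a \<in> \<omega>" "b \<in> \<omega>" for a b
        using Q_cases[OF that(1) succ_nat[OF step(1)] that(2,3)]
      proof (elim disjE bexE)
        fix t' a' b' assume "t' \<in> \<omega>" "a' \<in> \<omega>" "b' \<in> \<omega>"
          "Q t' a' b' \<and> succ V t = succ V t' \<and> ?next a' b' a b"
        moreover from this have "t = t'" using succ_inject[OF step(1)] by blast
        ultimately show ?thesis by blast
      qed (use succ_inject[OF step(1) zero_nat] in blast)
      show ?case
      proof (intro ballI impI)
        fix a b a' b' assume ab: "a \<in> \<omega>" "b \<in> \<omega>" "a' \<in> \<omega>" "b' \<in> \<omega>"
          "Q (succ V t) a b" "Q (succ V t) a' b'"
        show "a = a' \<and> b = b'"
        proof (cases "t = zero V")
          case True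
          then show ?thesis using *[OF ab(5,1,2)] *[OF ab(6,3,4)] not0 by blast
        next
          case False
          with *[OF ab(5,1,2)] obtain c d where c: "c \<in> \<omega>" "d \<in> \<omega>" "Q t c d" "?next c d a b" by blast
          from False *[OF ab(6,3,4)] obtain c' d'
            where c': "c' \<in> \<omega>" "d' \<in> \<omega>" "Q t c' d'" "?next c' d' a' b'" by blast
          have "c = c'" "d = d'" using step.IH c(1-3) c'(1-3) by blast+
          then show ?thesis using c(4) c'(4) by auto
        qed
      qed
    qed
    then show ?thesis using that by blast
  qed
  have Q_row: "\<exists>t\<in>\<omega>. Q t a b" if "t \<in> \<omega>" "a \<in> \<omega>" "Q t a (zero V)" "b \<in> ext V (apply_in V h a)"
    for t a b
  proof -
    have "b \<in> \<omega>" using nat_less_nat h(2) that by blast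
    then have "b \<in> ext V (apply_in V h a) \<longrightarrow> (\<exists>t\<in>\<omega>. Q t a b)"
    proof (induction rule: nat_induct)
      case definable show ?case unfolding Q_def by (intro definable_intros Q_definable omega h nat_elems that)
    next
      case base show ?case using that by blast
    next
      case (step b)
      show ?case
      proof
        assume b: "succ V b \<in> ext V (apply_in V h a)"
        moreover have "b \<in> ext V (succ V b)" using step(1) by (simp add: ext_succ nat_elems)
        ultimately have "b \<in> ext V (apply_in V h a)"
          using nat_less_trans[OF h(2)[OF \<open>a \<in> \<omega>\<close>]] by blast
        then obtain t where "t \<in> \<omega>" "Q t a b" using step.IH by blast
        then show "\<exists>t\<in>\<omega>. Q t a (succ V b)"
          using Q_step[of t a b a "succ V b"] b step(1) that(2) succ_nat by blast
      qed
    qed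
    then show ?thesis using that by blast
  qed
  have Q_surj: "\<exists>t\<in>\<omega>. Q t a b" if a: "a \<in> \<omega>" and b: "b \<in> ext V (apply_in V h a)" for a b
  proof -
    have "\<exists>t\<in>\<omega>. Q t a (zero V)" using a
    proof (induction rule: nat_induct)
      case definable show ?case unfolding Q_def by (intro definable_intros Q_definable omega)
    next
      case base show ?case using Q_start zero_nat succ_nat by blast
    next
      case (step a)
      then obtain t where t: "t \<in> \<omega>" "Q t a (zero V)" by blast
      \<comment> \<open>\<open>c\<close> is the last label of row \<open>a\<close>, since h a = c +
        1; after it the list moves on to row a + 1.\<close>
      obtain c where c: "c \<in> \<omega>" "apply_in V h a = succ V c"
        using nat_cases[OF h(2)[OF step(1)]] pos[OF step(1)] zero(2) by auto
      then have "c \<in> ext V (apply_in V h a)" by (simp add: ext_succ nat_elems)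
      from Q_row[OF t(1) step(1) t(2) this] obtain t' where t': "t' \<in> \<omega>" "Q t' a c" by blast
      then have "Q (succ V t') (succ V a) (zero V)"
        using Q_step[of t' a c "succ V a" "zero V"] step(1) c mem_irrefl[of "succ V c"]
          succ_nat zero_nat by simp
      then show ?case using succ_nat t' by blast
    qed
    then show ?thesis using Q_row a b by blast
  qed
  \<comment> \<open>\<open>P r a\<close> makes \<open>a\<close> the parent of \<open>r\<close>. Then
    \<open>reach V P t u\<close> descends from \<open>t\<close>: \<open>u\<close> is
    \<open>t\<close> or one of its ancestors.\<close>
  define P where "P r a \<longleftrightarrow> a \<in> \<omega> \<and> (\<exists>c\<in>\<omega>. Q r a c)" for r a
  have P: "definable V (\<lambda>e. P (e 0) (e (Suc 0)))"
    unfolding P_def Q_def by (intro definable_intros Q_definable omega)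
  have P_less: "a \<in> ext V r" if "P r a" "r \<in> \<omega>" for r a
    using that Q_bounds unfolding P_def by blast
  have P_fun: "a = a'" if "P r a" "P r a'" "r \<in> \<omega>" for r a a'
    using that Q_fun unfolding P_def by blast
  have reach_le: "u = t \<or> u \<in> ext V t" if "reach V P t u" "t \<in> \<omega>" for t u
    using that(1)
  proof (induction rule: reach_induct[where U="omega V"])
    case definable show ?case by (intro definable_intros nat_elems that)
  next
    case (step x y)
    then have "y \<in> ext V x" using P_less by blast
    then show ?case using step nat_less_trans[OF that(2)] by blast
  qed (use omega that P_def in auto)
  have reach_cases: "u = t \<or> (\<exists>c\<in>\<omega>. P t c \<and> reach V P c u)" if "reach V P t u" "t \<in> \<omega>" for t u
    by (rule reach_left_cases[OF that(1) P omega(1) _ that(2)]) (simp add: P_def)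
  have unique: "b = b'" if "t \<in> \<omega>" "s \<in> \<omega>" "b \<in> \<omega>" "b' \<in> \<omega>" "u \<in> \<omega>" "u' \<in> \<omega>"
    "Q u s b" "Q u' s b'" "reach V P t u" "reach V P t u'" for t s b b' u u'
  proof -
    \<comment> \<open>If \<open>t\<close> is itself a child of \<open>s\<close>, no other child of
      \<open>s\<close> lies further down its path: the path continues with \<open>s\<close> and
      smaller numbers, whereas children of \<open>s\<close> exceed \<open>s\<close>.\<close>
    have no_branch: False if "Q t s b" "Q u s b'" "P t c" "reach V P c u"
      "t \<in> \<omega>" "s \<in> \<omega>" "b \<in> \<omega>" "b' \<in> \<omega>" "c \<in> \<omega>" "u \<in> \<omega>" for t s b b' c u
    proof -
      have "P t s" using that unfolding P_def by blast
      then have "c = s" using P_fun that by blast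
      then have "u = s \<or> u \<in> ext V s" using reach_le that by blast
      moreover have "s \<in> ext V u" using Q_bounds that by blast
      ultimately show False using mem_irrefl nat_less_asym that by blast
    qed
    have "\<forall>s\<in>\<omega>. \<forall>b\<in>\<omega>. \<forall>b'\<in>\<omega>. \<forall>u\<in>\<omega>. \<forall>u'\<in>\<omega>.
        Q u s b \<longrightarrow> Q u' s b' \<longrightarrow> reach V P t u \<longrightarrow> reach V P t u' \<longrightarrow> b = b'"
      using \<open>t \<in> \<omega>\<close>
    proof (induction rule: nat_less_induct)
      case definable
      show ?case unfolding Q_def by (intro definable_intros Q_definable definable_reach[OF P] omega)
    next
      case (less t)
      show ?case
      proof (intro ballI impI)
        fix s b b' u u'
        assume *: "s \<in> \<omega>" "b \<in> \<omega>" "b' \<in> \<omega>" "u \<in> \<omega>" "u' \<in> \<omega>" "Q u s b" "Q u' s b'"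
          "reach V P t u" "reach V P t u'"
        consider "u = t" "u' = t" | c where "u = t" "c \<in> \<omega>" "P t c" "reach V P c u'"
          | c where "u' = t" "c \<in> \<omega>" "P t c" "reach V P c u"
          | c c' where "c \<in> \<omega>" "P t c" "reach V P c u" "c' \<in> \<omega>" "P t c'" "reach V P c' u'"
          using reach_cases[OF *(8) less(1)] reach_cases[OF *(9) less(1)] by blast
        then show "b = b'"
        proof cases
          case 1 then show ?thesis using Q_fun * by blast
        next
          case (2 c) then show ?thesis using no_branch[of t s b u' b' c] * less(1) by blast
        next
          case (3 c) then show ?thesis using no_branch[of t s b' u b c] * less(1) by blast
        next
          case (4 c c')
          \<comment> \<open>Both paths leave \<open>t\<close> through its only parent, which is
            smaller, so the induction hypothesis applies there.\<close>
          then have "c = c'" using P_fun less(1) by blast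
          moreover have "c \<in> ext V t" using P_less 4 less(1) by blast
          ultimately show ?thesis using less.IH[of c] 4 * by blast
        qed
      qed
    qed
    then show ?thesis using that by blast
  qed
  have "is_set V {z \<in> ext V U. \<exists>s\<in>\<omega>. \<exists>b\<in>\<omega>. \<exists>t\<in>\<omega>. z = triple V s b t \<and> Q t s b}"
    by (rule separation[OF U(1)], unfold Q_def, intro definable_intros Q_definable omega)
  then obtain E where E: "E \<in> elems V"
    "ext V E = {z \<in> ext V U. \<exists>s\<in>\<omega>. \<exists>b\<in>\<omega>. \<exists>t\<in>\<omega>. z = triple V s b t \<and> Q t s b}"
    by (auto simp: is_set_def)
  have E_iff: "triple V s b t \<in> ext V E \<longleftrightarrow> Q t s b" if "s \<in> \<omega>" "b \<in> \<omega>" "t \<in> \<omega>" for s b t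
    unfolding E(2) U(2) using that by (auto simp: nat_triple_inject)
  have "is_set V {z \<in> ext V U. \<exists>s\<in>\<omega>. \<exists>b\<in>\<omega>. \<exists>t\<in>\<omega>. z = triple V s b t \<and>
      (\<exists>u\<in>\<omega>. Q u s b \<and> reach V P t u)}"
    by (rule separation[OF U(1)], unfold Q_def, intro definable_intros Q_definable definable_reach[OF P] omega)
  then obtain D where D: "D \<in> elems V"
    "ext V D = {z \<in> ext V U. \<exists>s\<in>\<omega>. \<exists>b\<in>\<omega>. \<exists>t\<in>\<omega>. z = triple V s b t \<and>
      (\<exists>u\<in>\<omega>. Q u s b \<and> reach V P t u)}"
    by (auto simp: is_set_def)
  have D_iff: "triple V s b t \<in> ext V D \<longleftrightarrow> (\<exists>u\<in>\<omega>. Q u s b \<and> reach V P t u)"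
    if "s \<in> \<omega>" "b \<in> \<omega>" "t \<in> \<omega>" for s b t
    unfolding D(2) U(2) using that by (auto simp: nat_triple_inject)
  show thesis
  proof (rule that[OF E(1) D(1)])
    show "\<exists>t\<in>\<omega>. triple V s b t \<in> ext V E" if "s \<in> \<omega>" "b \<in> ext V (apply_in V h s)" for s b
      using Q_surj[OF that] E_iff that h(2) nat_less_nat by blast
    show "s \<in> ext V t" if "s \<in> \<omega>" "b \<in> \<omega>" "t \<in> \<omega>" "triple V s b t \<in> ext V E" for s b t
      using that E_iff Q_bounds by blast
    show "triple V s b t \<in> ext V D" if "s \<in> \<omega>" "b \<in> \<omega>" "t \<in> \<omega>" "triple V s b t \<in> ext V E" for s b t
      using that(4) reach_refl[of V P t] that(3) unfolding E_iff[OF that(1-3)] D_iff[OF that(1-3)]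
      by blast
    show "triple V s b t \<in> ext V D" if "r \<in> \<omega>" "c \<in> \<omega>" "s \<in> \<omega>" "b \<in> \<omega>" "t \<in> \<omega>"
      "triple V r c t \<in> ext V E" "triple V s b r \<in> ext V D" for r c s b t
    proof -
      have "P t r" unfolding P_def using that E_iff by blast
      moreover obtain u where "u \<in> \<omega>" "Q u s b" "reach V P r u"
        using D_iff[OF \<open>s \<in> \<omega>\<close> \<open>b \<in> \<omega>\<close> \<open>r \<in> \<omega>\<close>] \<open>triple V s b r \<in> ext V D\<close> by blast
      moreover have "reach V P t u"
        by (rule reach_step_left[of P t r, OF calculation(1) nat_elems]) fact+
      ultimately show ?thesis using D_iff[OF that(3-5)] by blast
    qed
    show "b = b'" if *: "s \<in> \<omega>" "b \<in> \<omega>" "b' \<in> \<omega>" "t \<in> \<omega>"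
      "triple V s b t \<in> ext V D" "triple V s b' t \<in> ext V D" for s b b' t
    proof -
      obtain u u' where "u \<in> \<omega>" "Q u s b" "reach V P t u" "u' \<in> \<omega>" "Q u' s b'" "reach V P t u'"
        using *(5,6) unfolding D_iff[OF *(1,2,4)] D_iff[OF *(1,3,4)] by blast
      with *(1-4) show ?thesis using unique[of t s b b' u u'] by simp
    qed
  qed
qed

end

section \<open>Two universes\<close>

locale universe_extension =
  V: zfc V + W: zfc W for V W :: "'a set_structure" +
  assumes subuniverse: "subuniverse V W"
begin

section \<open>Agreement of the two universes on basic notions\<close>

abbreviation "N \<equiv> ext W (omega W)"

lemma elems_sub: "x \<in> elems V \<Longrightarrow> x \<in> elems W"
  using subuniverse by (auto simp: subuniverse_def)

lemma ext_transitive: "x \<in> elems V \<Longrightarrow> y \<in> ext W x \<Longrightarrow> y \<in> elems V"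
  using subuniverse by (auto simp: subuniverse_def)

lemma ext_eq:
  assumes "x \<in> elems V"
  shows "ext V x = ext W x"
proof -
  have "z \<epsilon>\<^bsub>V\<^esub> x \<longleftrightarrow> z \<epsilon>\<^bsub>W\<^esub> x" if "z \<in> elems V" for z
    using subuniverse assms that by (auto simp: subuniverse_def)
  moreover have "z \<in> elems V" if "z \<in> elems W" "z \<epsilon>\<^bsub>W\<^esub> x" for z
    using ext_transitive[OF assms] that by (simp add: ext_def)
  ultimately show ?thesis unfolding ext_def using elems_sub by blast
qed

lemma the_set_eq:
  assumes "is_set V S"
  shows "the_set V S = the_set W S"
proof -
  have x: "the_set V S \<in> elems V" "ext V (the_set V S) = S" using V.the_set[OF assms] by auto
  show ?thesis using W.the_set_ext[OF elems_sub[OF x(1)]] ext_eq[OF x(1)] x(2) by simp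
qed

lemma upair_eq: "x \<in> elems V \<Longrightarrow> y \<in> elems V \<Longrightarrow> upair V x y = upair W x y"
  by (simp add: upair_def the_set_eq V.is_set_pair)

lemma opair_eq: "x \<in> elems V \<Longrightarrow> y \<in> elems V \<Longrightarrow> opair V x y = opair W x y"
  using V.upair by (simp add: opair_upair upair_eq[symmetric])

lemma triple_eq:
  "x \<in> elems V \<Longrightarrow> y \<in> elems V \<Longrightarrow> z \<in> elems V \<Longrightarrow> triple V x y z = triple W x y z"
  using V.opair_elems by (simp add: triple_def opair_eq[symmetric])

lemma zero_eq: "zero V = zero W"
  by (simp add: zero_def the_set_eq V.is_set_empty)

lemma succ_eq:
  assumes "x \<in> elems V"
  shows "succ V x = succ W x"
proof (rule W.extensionality)
  show "ext W (succ V x) = ext W (succ W x)"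
    using V.succ[OF assms] W.succ[OF elems_sub[OF assms]] ext_eq[OF assms] ext_eq[of "succ V x"]
    by simp
qed (use V.succ[OF assms] W.succ elems_sub assms in auto)

text \<open>The omega of \<open>V\<close> is inductive in \<open>W\<close>, which gives one
  inclusion. For the other, the difference is a set of \<open>W\<close>, and Foundation in
  \<open>W\<close> yields a minimal n in it. This n is the successor in \<open>V\<close> of some m,
  which by minimality is a natural number of \<open>W\<close>; hence so is n. Well-foundedness in
  HOL does not enter.\<close>

lemma omega_eq: "omega V = omega W"
proof (rule W.extensionality)
  show V: "omega V \<in> elems W" by (intro elems_sub V.omega)
  have eq: "ext V (omega V) = ext W (omega V)" by (intro ext_eq V.omega)
  have "is_inductive W (omega V)"
    unfolding W.is_inductive_iff eq[symmetric]
    using V V.zero_nat V.succ_nat V.nat_elems by (auto simp: zero_eq[symmetric] succ_eq[symmetric])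
  then have sup: "N \<subseteq> ext W (omega V)" using W.omega(2) by blast
  have "definable W (\<lambda>e. e 0 \<notin> N)" by (intro definable_intros W.omega)
  from W.separation[OF V this] obtain A
    where A: "A \<in> elems W" "ext W A = {z \<in> ext W (omega V). z \<notin> N}"
    by (auto simp: is_set_def)
  have "ext W A = {}"
  proof (rule ccontr)
    assume "ext W A \<noteq> {}"
    then obtain n where n: "n \<in> ext W A" "ext W n \<inter> ext W A = {}" using W.foundation A(1) by blast
    then have "n \<in> ext V (omega V)" "n \<notin> N" using A(2) eq by auto
    then obtain m where m: "m \<in> ext V (omega V)" "n = succ V m"
      using V.nat_cases W.zero_nat zero_eq by metis
    then have "m \<in> ext W n"
      using ext_eq[of n] V.ext_succ[of m] V.succ[of m] V.nat_elems[of m] by auto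
    then have "m \<in> N" using n(2) A(2) m(1) eq by blast
    then have "n \<in> N" using m W.succ_nat succ_eq V.nat_elems by metis
    with \<open>n \<notin> N\<close> show False by simp
  qed
  with A(2) sup show "ext W (omega V) = N" by blast
qed (rule W.omega)

lemma ext_omega: "ext V (omega V) = N"
  using ext_eq[OF V.omega(1)] omega_eq by simp

lemma N_elems: "n \<in> N \<Longrightarrow> n \<in> elems V"
  using V.nat_elems ext_omega by simp

text \<open>A pair in \<open>f\<close>, the doubleton inside the pair and then \<open>y\<close> all
  lie in \<open>V\<close> by transitivity, so \<open>W\<close> finds no additional values of
  \<open>f\<close>.\<close>

lemma opair_in_iff:
  assumes "f \<in> elems V" "x \<in> elems V"
  shows "y \<in> elems V \<and> opair V x y \<in> ext V f \<longleftrightarrow> y \<in> elems W \<and> opair W x y \<in> ext W f"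
proof
  assume "y \<in> elems W \<and> opair W x y \<in> ext W f"
  then have y: "y \<in> elems W" "opair W x y \<in> ext W f" by auto
  then have "opair W x y \<in> elems V" using ext_transitive assms by blast
  moreover have "upair W x y \<in> ext W (opair W x y)" "y \<in> ext W (upair W x y)"
    using y elems_sub assms W.upair by (auto simp: opair_upair)
  ultimately have "y \<in> elems V" using ext_transitive by blast
  with y assms show "y \<in> elems V \<and> opair V x y \<in> ext V f" by (simp add: opair_eq ext_eq)
qed (use assms in \<open>auto simp: opair_eq ext_eq elems_sub\<close>)

lemma app_eq: "f \<in> elems V \<Longrightarrow> x \<in> elems V \<Longrightarrow> app V f x = app W f x"
  by (simp add: app_def opair_in_iff)

lemma apply_in_eq: "f \<in> elems V \<Longrightarrow> x \<in> elems V \<Longrightarrow> apply_in V f x = apply_in W f x"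
  by (simp add: apply_in_def opair_in_iff app_eq zero_eq)

lemma function_on_eq:
  assumes "f \<in> elems V" "a \<in> elems V"
  shows "function_on V f a \<longleftrightarrow> function_on W f a"
proof -
  have "z \<in> {opair V x y |x y. x \<in> ext V a \<and> y \<in> elems V} \<longleftrightarrow>
      z \<in> {opair W x y |x y. x \<in> ext W a \<and> y \<in> elems W}" if "z \<in> ext V f" for z
  proof
    assume "z \<in> {opair V x y |x y. x \<in> ext V a \<and> y \<in> elems V}"
    then obtain x y where xy: "z = opair V x y" "x \<in> ext V a" "y \<in> elems V" by blast
    have "z = opair W x y" using xy(1) opair_eq[OF ext_elems[OF xy(2)] xy(3)] by simp
    with xy elems_sub ext_eq[OF assms(2)]
    show "z \<in> {opair W x y |x y. x \<in> ext W a \<and> y \<in> elems W}" by blast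
  next
    assume "z \<in> {opair W x y |x y. x \<in> ext W a \<and> y \<in> elems W}"
    then obtain x y where xy: "z = opair W x y" "x \<in> ext W a" "y \<in> elems W" by blast
    then have "x \<in> elems V" using ext_transitive assms by blast
    then have "y \<in> elems V"
      using opair_in_iff[OF assms(1)] xy that ext_eq[OF assms(1)] by blast
    then have "z = opair V x y" using xy(1) opair_eq[OF \<open>x \<in> elems V\<close>] by simp
    with xy(2) \<open>y \<in> elems V\<close> show "z \<in> {opair V x y |x y. x \<in> ext V a \<and> y \<in> elems V}"
      using ext_eq[OF assms(2)] by blast
  qed
  then have "ext V f \<subseteq> {opair V x y |x y. x \<in> ext V a \<and> y \<in> elems V} \<longleftrightarrow>
      ext V f \<subseteq> {opair W x y |x y. x \<in> ext W a \<and> y \<in> elems W}" by blast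
  moreover have "(\<exists>!y. y \<in> elems V \<and> opair V x y \<in> ext V f) \<longleftrightarrow>
      (\<exists>!y. y \<in> elems W \<and> opair W x y \<in> ext W f)" if "x \<in> ext V a" for x
    by (simp add: opair_in_iff[OF assms(1) ext_elems[OF that]])
  ultimately show ?thesis
    using assms elems_sub ext_eq unfolding function_on_def by simp
qed

lemma function_on_omega_eq: "f \<in> elems V \<Longrightarrow> function_on V f (omega V) \<longleftrightarrow> function_on W f (omega W)"
  by (simp add: function_on_eq V.omega omega_eq[symmetric])

text \<open>Passes a function defined inside \<open>V\<close> to \<open>W\<close>, in the form over
  which the hypotheses on \<rho> and the claim about f quantify.\<close>

lemma function_in_V:
  assumes "definable V (\<lambda>e. R (e 0) (e (Suc 0)))" "\<And>x. x \<in> N \<Longrightarrow> \<exists>!y. y \<in> N \<and> R x y"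
  obtains f where "f \<in> baire W" "f \<in> elems V" "\<And>x. x \<in> N \<Longrightarrow> R x (app W f x)"
proof -
  obtain f where f: "function_on V f (omega V)"
    "\<And>x. x \<in> N \<Longrightarrow> app V f x \<in> N \<and> R x (app V f x)"
    using V.function_exists[OF V.omega(1) V.omega(1) assms(1)] assms(2) unfolding ext_omega by blast
  then have "f \<in> elems V" by (simp add: function_on_def)
  with f show thesis
    by (intro that[of f]) (auto simp: baire_def function_on_omega_eq app_eq N_elems)
qed

section \<open>The branch selected by \<eta> and its sparseness\<close>

definition sparse :: "'a \<Rightarrow> bool" where
  "sparse X \<longleftrightarrow> (\<forall>f\<in>baire W \<inter> elems V. (\<forall>n\<in>N. n \<in> ext W (app W f n)) \<longrightarrow>
     (\<exists>k\<in>N. \<forall>m\<in>ext W X. app W f m \<in> ext W X \<longrightarrow> m \<in> ext W k))"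

text \<open>\<open>sparse\<close> asks for a bound instead of finiteness, which avoids enumerations
  here; inside \<open>W\<close> the two agree for sets of natural numbers.\<close>

lemma sparse_set_exists:
  assumes h: "h \<in> baire W" "h \<in> elems V" and \<eta>: "\<eta> \<in> product W h"
    and evade: "\<forall>\<rho>\<in>product W h \<inter> elems V. almost_all W (\<lambda>n. app W \<rho> n \<noteq> app W \<eta> n)"
  obtains X where "X \<in> elems W" "ext W X \<subseteq> N" "\<not> finite_in W (ext W X)" "sparse X"
proof -
  have h_fun: "function_on W h (omega W)" and h_nat: "\<And>n. n \<in> N \<Longrightarrow> app W h n \<in> N"
    using h(1) by (auto simp: baire_def)
  have \<eta>_fun: "function_on W \<eta> (omega W)" and \<eta>_elems: "\<eta> \<in> elems W"
    using \<eta> by (auto simp: product_def function_on_def)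
  have \<eta>_less: "app W \<eta> n \<in> ext W (app W h n)" if "n \<in> N" for n
    using \<eta> that W.apply_in_eq_app[OF \<eta>_fun that] W.apply_in_elems[of \<eta> n]
    by (auto simp: product_def ext_def)
  have \<eta>_nat: "app W \<eta> n \<in> N" if "n \<in> N" for n
    using W.nat_less_nat[OF h_nat \<eta>_less] that by blast
  have h_eq: "apply_in V h n = app W h n" if "n \<in> N" for n
    using V.apply_in_eq_app[of h "omega V"] h_fun h(2) that
    by (simp add: function_on_omega_eq ext_omega app_eq N_elems)
  have ext_h: "ext V (app W h n) = ext W (app W h n)" if "n \<in> N" for n
    by (intro ext_eq N_elems h_nat that)
  have pos: "zero V \<in> ext V (apply_in V h n)" if "n \<in> N" for n
  proof -
    \<comment> \<open>The value of \<eta> at n is a member of h n, so h has no zero values and every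
      node has a child.\<close>
    have "app W h n \<noteq> zero W" using \<eta>_less[OF that] W.zero(2) by auto
    then have "zero W \<in> ext W (app W h n)" using W.nat_zero_or_pos[OF h_nat[OF that]] by blast
    then show ?thesis using that by (simp add: h_eq ext_h zero_eq)
  qed
  have triple: "triple V s b t = triple W s b t" if "s \<in> N" "b \<in> N" "t \<in> N" for s b t
    using that N_elems by (intro triple_eq) auto
  obtain E D where ED: "E \<in> elems V" "D \<in> elems V"
    and child: "\<And>s b. s \<in> N \<Longrightarrow> b \<in> N \<Longrightarrow> b \<in> ext W (app W h s) \<Longrightarrow> \<exists>t\<in>N. triple W s b t \<in> ext W E"
    and E_less: "\<And>s b t. s \<in> N \<Longrightarrow> b \<in> N \<Longrightarrow> t \<in> N \<Longrightarrow> triple W s b t \<in> ext W E \<Longrightarrow> s \<in> ext W t"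
    and E_D: "\<And>s b t. s \<in> N \<Longrightarrow> b \<in> N \<Longrightarrow> t \<in> N \<Longrightarrow> triple W s b t \<in> ext W E \<Longrightarrow> triple W s b t \<in> ext W D"
    and D_step: "\<And>r c s b t. r \<in> N \<Longrightarrow> c \<in> N \<Longrightarrow> s \<in> N \<Longrightarrow> b \<in> N \<Longrightarrow> t \<in> N \<Longrightarrow>
      triple W r c t \<in> ext W E \<Longrightarrow> triple W s b r \<in> ext W D \<Longrightarrow> triple W s b t \<in> ext W D"
    and D_unique: "\<And>s b b' t. s \<in> N \<Longrightarrow> b \<in> N \<Longrightarrow> b' \<in> N \<Longrightarrow> t \<in> N \<Longrightarrow>
      triple W s b t \<in> ext W D \<Longrightarrow> triple W s b' t \<in> ext W D \<Longrightarrow> b = b'"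
  proof (rule V.labelled_tree[OF h(2)], unfold ext_omega)
    show "apply_in V h n \<in> N" if "n \<in> N" for n using that by (simp add: h_eq h_nat)
    show "zero V \<in> ext V (apply_in V h n)" if "n \<in> N" for n using pos that .
    fix E D assume *: "E \<in> elems V" "D \<in> elems V"
      "\<And>s b. s \<in> N \<Longrightarrow> b \<in> ext V (apply_in V h s) \<Longrightarrow> \<exists>t\<in>N. triple V s b t \<in> ext V E"
      "\<And>s b t. s \<in> N \<Longrightarrow> b \<in> N \<Longrightarrow> t \<in> N \<Longrightarrow> triple V s b t \<in> ext V E \<Longrightarrow> s \<in> ext V t"
      "\<And>s b t. s \<in> N \<Longrightarrow> b \<in> N \<Longrightarrow> t \<in> N \<Longrightarrow> triple V s b t \<in> ext V E \<Longrightarrow> triple V s b t \<in> ext V D"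
      "\<And>r c s b t. r \<in> N \<Longrightarrow> c \<in> N \<Longrightarrow> s \<in> N \<Longrightarrow> b \<in> N \<Longrightarrow> t \<in> N \<Longrightarrow>
        triple V r c t \<in> ext V E \<Longrightarrow> triple V s b r \<in> ext V D \<Longrightarrow> triple V s b t \<in> ext V D"
      "\<And>s b b' t. s \<in> N \<Longrightarrow> b \<in> N \<Longrightarrow> b' \<in> N \<Longrightarrow> t \<in> N \<Longrightarrow>
        triple V s b t \<in> ext V D \<Longrightarrow> triple V s b' t \<in> ext V D \<Longrightarrow> b = b'"
    have eqs: "ext V E = ext W E" "ext V D = ext W D" using *(1,2) by (simp_all add: ext_eq)
    show thesis
    proof (rule that[OF *(1,2)])
      show "\<exists>t\<in>N. triple W s b t \<in> ext W E" if "s \<in> N" "b \<in> N" "b \<in> ext W (app W h s)" for s b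
        using *(3)[of s b] that by (simp add: h_eq ext_h eqs triple cong: bex_cong)
      show "s \<in> ext W t" if "s \<in> N" "b \<in> N" "t \<in> N" "triple W s b t \<in> ext W E" for s b t
        using *(4)[of s b t] that by (simp add: eqs triple ext_eq N_elems)
      show "triple W s b t \<in> ext W D" if "s \<in> N" "b \<in> N" "t \<in> N" "triple W s b t \<in> ext W E" for s b t
        using *(5)[of s b t] that by (simp add: eqs triple)
      show "triple W s b t \<in> ext W D" if "r \<in> N" "c \<in> N" "s \<in> N" "b \<in> N" "t \<in> N"
        "triple W r c t \<in> ext W E" "triple W s b r \<in> ext W D" for r c s b t
        using *(6)[of r c s b t] that by (simp add: eqs triple)
      show "b = b'" if "s \<in> N" "b \<in> N" "b' \<in> N" "t \<in> N"
        "triple W s b t \<in> ext W D" "triple W s b' t \<in> ext W D" for s b b' t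
        using *(7)[of s b b' t] that by (simp add: eqs triple)
    qed
  qed
  note ED_W = ED[THEN elems_sub]
  \<comment> \<open>Taking the least child makes the next node unique without knowing that only one
    node carries the given label at a.\<close>
  define next_node where "next_node a t \<longleftrightarrow> t \<in> N \<and> triple W a (apply_in W \<eta> a) t \<in> ext W E \<and>
    (\<forall>t'\<in>ext W t. triple W a (apply_in W \<eta> a) t' \<notin> ext W E)" for a t
  have \<eta>_eq: "apply_in W \<eta> a = app W \<eta> a" if "a \<in> N" for a
    using W.apply_in_eq_app[OF \<eta>_fun that] .
  have next_def: "definable W (\<lambda>e. next_node (e 0) (e (Suc 0)))"
    unfolding next_node_def by (intro definable_intros W.omega \<eta>_elems ED_W)
  have next_ex: "\<exists>t\<in>N. next_node a t" if a: "a \<in> N" for a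
  proof -
    obtain t where "t \<in> N" "triple W a (apply_in W \<eta> a) t \<in> ext W E"
      using child[OF a \<eta>_nat[OF a] \<eta>_less[OF a]] \<eta>_eq[OF a] by auto
    moreover have "definable W (\<lambda>e. triple W a (apply_in W \<eta> a) (e 0) \<in> ext W E)"
      by (intro definable_intros ED_W \<eta>_elems W.nat_elems a)
    ultimately show ?thesis
      using W.nat_least[of t "\<lambda>t. triple W a (apply_in W \<eta> a) t \<in> ext W E"]
      unfolding next_node_def by blast
  qed
  have next_fun: "t = t'" if "next_node a t" "next_node a t'" for a t t'
    using that W.nat_linear[of t t'] unfolding next_node_def by blast
  have next_less: "a \<in> ext W t" if "next_node a t" "a \<in> N" for a t
    using that E_less \<eta>_nat \<eta>_eq unfolding next_node_def by metis
  have "is_set W {u \<in> N. reach W next_node (zero W) u}"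
    by (rule W.separation[OF W.omega(1)], intro definable_reach[OF next_def] definable_intros W.zero)
  then obtain X where X: "X \<in> elems W" "ext W X = {u \<in> N. reach W next_node (zero W) u}"
    by (auto simp: is_set_def)
  have X_sub: "ext W X \<subseteq> N" using X(2) by blast
  have X_zero: "zero W \<in> ext W X" using X(2) W.zero_nat by (simp add: reach_refl)
  have X_next: "t \<in> ext W X" if "a \<in> ext W X" "next_node a t" for a t
  proof -
    have "t \<in> N" using that(2) by (simp add: next_node_def)
    moreover have "reach W next_node (zero W) t"
      using that(1) reach_step[of W next_node "zero W" a t, OF _ that(2) W.nat_elems[OF calculation]] X(2) by simp
    ultimately show ?thesis using X(2) by simp
  qed
  have X_cases: "t = zero W \<or> (\<exists>a\<in>ext W X. next_node a t)" if "t \<in> ext W X" for t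
  proof -
    have "t = zero W \<or> (\<exists>a\<in>N. reach W next_node (zero W) a \<and> next_node a t)"
      by (rule W.reach_right_cases[OF _ next_def W.omega(1) _ W.zero_nat])
        (use that X(2) in \<open>simp_all add: next_node_def[THEN iffD1, THEN conjunct1]\<close>)
    then show ?thesis using X(2) by blast
  qed
  have X_unbounded: "\<exists>t\<in>ext W X. t = m \<or> m \<in> ext W t" if "m \<in> N" for m
    using that
  proof (induction rule: W.nat_induct)
    case definable show ?case by (intro definable_intros X)
  next
    case base show ?case using X_zero by blast
  next
    case (step m)
    then obtain t where t: "t \<in> ext W X" "t = m \<or> m \<in> ext W t" by blast
    then obtain t' where t': "next_node t t'" "t' \<in> N" using next_ex X_sub by blast
    have "t \<in> ext W t'" using next_less t' t X_sub by blast
    then have "m \<in> ext W t'" using t W.nat_less_trans[OF t'(2)] by blast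
    then show ?case using W.succ_le[OF t'(2)] X_next[OF t(1) t'(1)] by metis
  qed
  have path: "triple W s (app W \<eta> s) t \<in> ext W D"
    if "t \<in> ext W X" "s \<in> ext W X" "s \<in> ext W t" for s t
  proof -
    \<comment> \<open>The induction needs more than the claim about \<open>D\<close>: the successor
      of s on the branch is at most t, so the branch has no nodes between consecutive ones.\<close>
    have "t \<in> ext W X \<longrightarrow> (\<forall>s\<in>ext W X. s \<in> ext W t \<longrightarrow> triple W s (apply_in W \<eta> s) t \<in> ext W D \<and>
        (\<forall>u\<in>N. next_node s u \<longrightarrow> u = t \<or> u \<in> ext W t))"
      using X_sub[THEN subsetD, OF that(1)]
    proof (induction rule: W.nat_less_induct)
      case definable
      show ?case by (intro definable_intros definable_relation[OF next_def] W.omega X(1) \<eta>_elems ED_W)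
    next
      case (less t)
      show ?case
      proof (intro impI ballI)
        fix s assume t: "t \<in> ext W X" and s: "s \<in> ext W X" "s \<in> ext W t"
        then have "t \<noteq> zero W" using W.zero(2) by auto
        then obtain r where r: "r \<in> ext W X" "next_node r t" using X_cases t by blast
        have r_less: "r \<in> ext W t" using next_less r X_sub by blast
        have nat: "s \<in> N" "r \<in> N" using s r X_sub by auto
        have E: "triple W r (apply_in W \<eta> r) t \<in> ext W E" using r(2) by (simp add: next_node_def)
        consider "s \<in> ext W r" | "s = r" | "r \<in> ext W s" using W.nat_linear nat by blast
        then show "triple W s (apply_in W \<eta> s) t \<in> ext W D \<and>
            (\<forall>u\<in>N. next_node s u \<longrightarrow> u = t \<or> u \<in> ext W t)"
        proof cases
          case 1
          then have IH: "triple W s (apply_in W \<eta> s) r \<in> ext W D"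
              "\<forall>u\<in>N. next_node s u \<longrightarrow> u = r \<or> u \<in> ext W r"
            using less.IH[OF r_less] r(1) s(1) by auto
          have "triple W s (apply_in W \<eta> s) t \<in> ext W D"
            using D_step[OF _ _ _ _ _ E IH(1)] nat less(1) \<eta>_nat \<eta>_eq by simp
          then show ?thesis using IH(2) r_less W.nat_less_trans[OF less(1)] by blast
        next
          case 2
          then show ?thesis using E_D[OF _ _ _ E] nat less(1) \<eta>_nat \<eta>_eq next_fun r(2) by auto
        next
          case 3
          \<comment> \<open>A node s strictly between r and its successor t is impossible: the
            strengthened hypothesis at s, applied to r, puts t at or below s.\<close>
          then have "t = s \<or> t \<in> ext W s" using less.IH[OF s(2)] s(1) r less(1) by blast
          then show ?thesis using s(2) W.mem_irrefl W.nat_less_asym[OF less(1)] by blast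
        qed
      qed
    qed
    then show ?thesis using that \<eta>_eq[OF X_sub[THEN subsetD, OF that(2)]] by auto
  qed
  have "\<not> finite_in W (ext W X)"
  proof
    assume "finite_in W (ext W X)"
    then obtain m where m: "m \<in> N" "ext W X \<subseteq> ext W m"
      using W.finite_in_imp_bounded X_sub by blast
    then show False using X_unbounded[OF m(1)] W.mem_irrefl W.nat_less_asym[OF m(1)] by blast
  qed
  moreover have "sparse X"
    unfolding sparse_def
  proof (intro ballI impI)
    fix f assume "f \<in> baire W \<inter> elems V" and f_less: "\<forall>n\<in>N. n \<in> ext W (app W f n)"
    then have f: "function_on W f (omega W)" "f \<in> elems V" and f_nat: "\<And>n. n \<in> N \<Longrightarrow> app W f n \<in> N"
      by (auto simp: baire_def)
    have f_eq: "apply_in V f n = app W f n" if "n \<in> N" for n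
      using W.apply_in_eq_app[OF f(1) that] apply_in_eq[OF f(2)] N_elems[OF that] by simp
    \<comment> \<open>\<rho> s is the label below h s that \<open>D\<close> assigns to s and f s. If
      there is none it is 0, a legal value because h s is positive. All of this refers to objects of
      \<open>V\<close> only.\<close>
    let ?R = "\<lambda>s b. b \<in> ext V (apply_in V h s) \<and> (triple V s b (apply_in V f s) \<in> ext V D \<or>
      (\<forall>b'\<in>ext V (apply_in V h s). triple V s b' (apply_in V f s) \<notin> ext V D) \<and> b = zero V)"
    have D_uniq: "b = b'" if "s \<in> N" "b \<in> ext V (apply_in V h s)" "b' \<in> ext V (apply_in V h s)"
      "triple V s b (apply_in V f s) \<in> ext V D" "triple V s b' (apply_in V f s) \<in> ext V D" for s b b'
    proof -
      have *: "b \<in> N" "b' \<in> N"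
        using W.nat_less_nat[OF h_nat[OF that(1)]] that(1-3) by (auto simp: h_eq ext_h)
      show ?thesis
        using D_unique[OF that(1) * f_nat[OF that(1)]] that(1,4,5) * f_nat
        by (simp add: triple f_eq ext_eq ED)
    qed
    have "definable V (\<lambda>e. ?R (e 0) (e (Suc 0)))"
      by (intro definable_intros h f ED)
    moreover have "\<exists>!b. b \<in> N \<and> ?R s b" if s: "s \<in> N" for s
    proof -
      have N: "b \<in> N" if "b \<in> ext V (apply_in V h s)" for b
        using that W.nat_less_nat[OF h_nat[OF s]] s by (simp add: h_eq ext_h)
      show ?thesis
      proof (cases "\<exists>b\<in>ext V (apply_in V h s). triple V s b (apply_in V f s) \<in> ext V D")
        case True then show ?thesis using D_uniq[OF s] N by blast
      next
        case False then show ?thesis using pos[OF s] N by blast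
      qed
    qed
    ultimately obtain \<rho> where \<rho>: "\<rho> \<in> baire W" "\<rho> \<in> elems V" "\<And>s. s \<in> N \<Longrightarrow> ?R s (app W \<rho> s)"
      using function_in_V[of ?R] by blast
    have "app W \<rho> s \<in> ext W (app W h s)" if "s \<in> N" for s
      using \<rho>(3)[OF that] that by (simp add: h_eq ext_h)
    then have "\<rho> \<in> product W h" using \<rho>(1) by (auto simp: product_def baire_def ext_def)
    then have "finite_in W {n \<in> N. \<not> app W \<rho> n \<noteq> app W \<eta> n}"
      using evade \<rho>(2) by (auto simp: almost_all_def)
    then obtain k where k: "k \<in> N" "{n \<in> N. \<not> app W \<rho> n \<noteq> app W \<eta> n} \<subseteq> ext W k"
      using W.finite_in_imp_bounded by blast
    have "s \<in> ext W k" if "s \<in> ext W X" "app W f s \<in> ext W X" for s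
    proof -
      have s: "s \<in> N" using that X_sub by blast
      have "triple W s (app W \<eta> s) (app W f s) \<in> ext W D" using path that f_less s by blast
      then have *: "triple V s (app W \<eta> s) (apply_in V f s) \<in> ext V D"
        using s \<eta>_nat f_nat by (simp add: triple f_eq ext_eq ED)
      moreover have "app W \<eta> s \<in> ext V (apply_in V h s)" using \<eta>_less s by (simp add: h_eq ext_h)
      ultimately have "app W \<rho> s = app W \<eta> s" using \<rho>(3)[OF s] D_uniq[OF s] by blast
      then show ?thesis using k s by blast
    qed
    then show "\<exists>k\<in>N. \<forall>m\<in>ext W X. app W f m \<in> ext W X \<longrightarrow> m \<in> ext W k" using k by blast
  qed
  ultimately show thesis by (intro that[OF X(1) X_sub])
qed

text \<open>Infinity of \<open>Y\<close> needs its own argument: otherwise \<open>X\<close> contains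
  all large numbers, and sparseness fails for the successor function. The pairs that miss
  \<open>Y\<close> are those contained in \<open>X\<close>; sparseness bounds their minima, and
  disjointness then bounds their indices.\<close>

lemma sparse_complement_large:
  assumes X: "X \<in> elems W" "ext W X \<subseteq> N" "\<not> finite_in W (ext W X)" "sparse X"
    and Y: "Y \<in> elems W" "ext W Y = N - ext W X"
  shows "large_2_0 V W Y"
  unfolding large_2_0_def
proof (intro conjI ballI impI Y(1))
  show "ext W Y \<subseteq> N" using Y by blast
  have "N - ext W Y = ext W X" using X(2) Y by blast
  then show "\<not> finite_in W (N - ext W Y)" using X(3) by simp
  show "\<not> finite_in W (ext W Y)"
  proof
    assume "finite_in W (ext W Y)"
    then obtain m where m: "m \<in> N" "ext W Y \<subseteq> ext W m"
      using W.finite_in_imp_bounded Y(2) by blast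
    have "definable V (\<lambda>e. e (Suc 0) = succ V (e 0))"
      by (intro definable_intros )
    moreover have "\<exists>!y. y \<in> N \<and> y = succ V x" if "x \<in> N" for x
      using W.succ_nat[OF that] succ_eq N_elems[OF that] by auto
    ultimately obtain f where f: "f \<in> baire W" "f \<in> elems V" "\<And>x. x \<in> N \<Longrightarrow> app W f x = succ V x"
      using function_in_V[of "\<lambda>x y. y = succ V x"] by blast
    then have f_succ: "app W f x = succ W x" if "x \<in> N" for x
      using that succ_eq N_elems by simp
    then have "\<forall>n\<in>N. n \<in> ext W (app W f n)" using W.ext_succ W.nat_elems by simp
    then obtain k where k: "k \<in> N" "\<forall>s\<in>ext W X. app W f s \<in> ext W X \<longrightarrow> s \<in> ext W k"
      using X(4) f(1,2) unfolding sparse_def by blast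
    \<comment> \<open>Beyond both bounds, l and l + 1 belong to \<open>X\<close>, so sparseness
      would put l below k.\<close>
    obtain l where l: "l \<in> N" "m \<in> ext W l" "k \<in> ext W l" using W.nat_upper_bound m(1) k(1) by blast
    have l': "succ W l \<in> N" "m \<in> ext W (succ W l)"
      using l W.succ_nat W.ext_succ W.nat_elems by auto
    have "l \<in> ext W X" "succ W l \<in> ext W X"
      using l l' m Y(2) W.nat_less_asym by blast+
    then have "l \<in> ext W k" using k f_succ l by simp
    then show False using l W.nat_less_asym by blast
  qed
  fix K assume K: "K \<in> elems V" and *: "function_on W K (omega W) \<and>
    (\<forall>n\<in>N. \<exists>a\<in>N. \<exists>b\<in>N. a \<noteq> b \<and> ext W (app W K n) = {a, b}) \<and>
    (\<forall>m\<in>N. \<forall>n\<in>N. m \<noteq> n \<longrightarrow> ext W (app W K m) \<inter> ext W (app W K n) = {})"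
  then have K_fun: "function_on W K (omega W)"
    and two: "\<And>n. n \<in> N \<Longrightarrow> \<exists>a\<in>N. \<exists>b\<in>N. a \<noteq> b \<and> ext W (app W K n) = {a, b}"
    and disjoint: "\<And>m n x. m \<in> N \<Longrightarrow> n \<in> N \<Longrightarrow> x \<in> ext W (app W K m) \<Longrightarrow>
      x \<in> ext W (app W K n) \<Longrightarrow> m = n"
    by blast+
  have K_eq: "apply_in W K n = app W K n" if "n \<in> N" for n
    using W.apply_in_eq_app[OF K_fun that] .
  have K_ext: "ext V (apply_in V K n) = ext W (app W K n)" if "n \<in> N" for n
    using ext_eq[OF V.apply_in_elems[of K n]] apply_in_eq[OF K N_elems[OF that]] K_eq[OF that]
    by simp
  let ?S = "\<lambda>a b. \<exists>n\<in>N. a \<in> ext W (app W K n) \<and> b \<in> ext W (app W K n)"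
  \<comment> \<open>f maps a to the larger partner of a, if there is one, and to a + 1 otherwise, so
    that a < f a holds everywhere. It is phrased in \<open>V\<close> to be definable there;
    \<open>R_iff\<close> translates it to \<open>W\<close>.\<close>
  let ?R = "\<lambda>a b. a \<in> ext V b \<and> ((\<exists>n\<in>ext V (omega V). a \<in> ext V (apply_in V K n) \<and> b \<in> ext V (apply_in V K n)) \<or>
    \<not> (\<exists>b'\<in>ext V (omega V). a \<in> ext V b' \<and>
      (\<exists>n\<in>ext V (omega V). a \<in> ext V (apply_in V K n) \<and> b' \<in> ext V (apply_in V K n))) \<and> b = succ V a)"
  have R_iff: "?R a b \<longleftrightarrow> a \<in> ext W b \<and>
      (?S a b \<or> \<not> (\<exists>b'\<in>N. a \<in> ext W b' \<and> ?S a b') \<and> b = succ W a)" if "a \<in> N" "b \<in> N" for a b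
    using that by (simp add: ext_omega K_ext ext_eq N_elems succ_eq cong: bex_cong conj_cong)
  have S_unique: "b = b'" if S: "?S a b" "?S a b'" "a \<in> ext W b" "a \<in> ext W b'" for a b b'
  proof -
    obtain n where n: "n \<in> N" "a \<in> ext W (app W K n)" "b \<in> ext W (app W K n)"
      \<comment> \<open>Disjointness puts both partners of a in the same pair, which has only one
        element besides a.\<close>
      "b' \<in> ext W (app W K n)" using S(1,2) disjoint by blast
    with two obtain c d where "ext W (app W K n) = {c, d}" by blast
    with n that(3,4) W.mem_irrefl show ?thesis by auto
  qed
  have "definable V (\<lambda>e. ?R (e 0) (e (Suc 0)))"
    by (intro definable_intros V.omega K)
  moreover have "\<exists>!b. b \<in> N \<and> ?R a b" if a: "a \<in> N" for a
  proof (cases "\<exists>b'\<in>N. a \<in> ext W b' \<and> ?S a b'")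
    case True
    then obtain b where b: "b \<in> N" "a \<in> ext W b" "?S a b" by blast
    show ?thesis
    proof (rule ex1I)
      show "b \<in> N \<and> ?R a b" using R_iff[OF a b(1)] b by blast
      fix c assume c: "c \<in> N \<and> ?R a c"
      then have "a \<in> ext W c" "?S a c" using R_iff[OF a, of c] b by blast+
      then show "c = b" using S_unique b(2,3) by simp
    qed
  next
    case False
    moreover have "succ W a \<in> N" "a \<in> ext W (succ W a)"
      using a W.succ_nat W.ext_succ W.nat_elems by auto
    ultimately have "b \<in> N \<and> ?R a b \<longleftrightarrow> b = succ W a" for b
      using R_iff[OF a, of b] R_iff[OF a, of "succ W a"] by blast
    then show ?thesis by simp
  qed
  ultimately obtain f where f: "f \<in> baire W" "f \<in> elems V" "\<And>a. a \<in> N \<Longrightarrow> ?R a (app W f a)"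
    using function_in_V[of ?R] by blast
  have f_nat: "app W f a \<in> N" if "a \<in> N" for a using f(1) that by (auto simp: baire_def)
  have f_less: "a \<in> ext W (app W f a)" if "a \<in> N" for a
    using f(3)[OF that] R_iff[OF that f_nat[OF that]] by blast
  have f_partner: "app W f a = b" if "a \<in> N" "b \<in> N" "a \<in> ext W b" "?S a b" for a b
    using f(3)[OF that(1)] R_iff[OF that(1) f_nat[OF that(1)]] S_unique that by blast
  obtain m where m: "m \<in> N" "\<forall>s\<in>ext W X. app W f s \<in> ext W X \<longrightarrow> s \<in> ext W m"
    using X(4) f(1,2) f_less unfolding sparse_def by blast
  let ?B = "{n \<in> N. \<forall>a\<in>ext W (apply_in W K n). a \<notin> ext W Y}"
  have meets: "\<exists>a\<in>ext W (apply_in W K n). a \<in> ext W m" if "n \<in> ?B" for n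
  proof -
    have n: "n \<in> N" using that by simp
    obtain a b where ab: "a \<in> N" "b \<in> N" "a \<in> ext W b" "ext W (app W K n) = {a, b}"
      using two[OF n] W.nat_linear by (metis insert_commute)
    then have "a \<in> ext W X" "b \<in> ext W X" using that n Y(2) by (auto simp: K_eq)
    moreover have "app W f a = b" using f_partner ab n by blast
    ultimately show ?thesis using m(2) ab n by (auto simp: K_eq)
  qed
  \<comment> \<open>Each number below m lies in at most one of the disjoint pairs, so by induction
    on m the indices of pairs meeting m are bounded.\<close>
  have "\<exists>k\<in>N. \<forall>n\<in>N. (\<exists>a\<in>ext W (apply_in W K n). a \<in> ext W m) \<longrightarrow> n \<in> ext W k"
    using m(1)
  proof (induction rule: W.nat_induct)
    case definable
    show ?case by (intro definable_intros W.omega elems_sub K)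
  next
    case base show ?case using W.zero W.zero_nat by blast
  next
    case (step m)
    then obtain k where k: "k \<in> N"
      "\<forall>n\<in>N. (\<exists>a\<in>ext W (apply_in W K n). a \<in> ext W m) \<longrightarrow> n \<in> ext W k" by blast
    have m': "ext W (succ W m) = insert m (ext W m)" using step(1) W.ext_succ W.nat_elems by blast
    show ?case
    proof (cases "\<exists>n\<in>N. m \<in> ext W (apply_in W K n)")
      case True
      then obtain n where n: "n \<in> N" "m \<in> ext W (apply_in W K n)" by blast
      then obtain l where l: "l \<in> N" "k \<in> ext W l" "n \<in> ext W l"
        using W.nat_upper_bound k(1) by blast
      have "i \<in> ext W l" if "i \<in> N" "\<exists>a\<in>ext W (apply_in W K i). a \<in> ext W (succ W m)" for i
      proof (cases "m \<in> ext W (apply_in W K i)")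
        case True
        then have "i = n" using disjoint n that(1) by (simp add: K_eq)
        then show ?thesis using l by simp
      next
        case False
        then have "i \<in> ext W k" using that k m' by auto
        then show ?thesis using W.nat_less_trans[OF l(1,2)] by blast
      qed
      then show ?thesis using l(1) by blast
    next
      case False
      then show ?thesis using k by (intro bexI[of _ k]) (auto simp: m')
    qed
  qed
  then obtain k where k: "k \<in> N" "?B \<subseteq> ext W k" using meets by blast
  have "is_set W ?B"
    by (rule W.separation[OF W.omega(1)],
        intro definable_intros Y(1) elems_sub K)
  then have "finite_in W ?B" using W.bounded_imp_finite_in k by blast
  moreover have "?B = {n \<in> N. \<not> ext W (app W K n) \<inter> ext W Y \<noteq> {}}" using K_eq by auto
  ultimately show "almost_all W (\<lambda>n. ext W (app W K n) \<inter> ext W Y \<noteq> {})"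
    unfolding almost_all_def by simp
qed

end

theorem theorem4p1:
  fixes V W :: "'a set_structure" and h :: 'a
  assumes "zfc_model V" and "zfc_model W" and "subuniverse V W"
    and "h \<in> baire W \<inter> elems V"
    and "\<forall>m\<in>ext W (omega W). \<forall>n\<in>ext W (omega W).
           m \<epsilon>\<^bsub>W\<^esub> n \<longrightarrow> app W h m \<epsilon>\<^bsub>W\<^esub> app W h n"
    and "\<exists>\<eta>\<in>product W h. \<forall>\<rho>\<in>product W h \<inter> elems V.
           almost_all W (\<lambda>n. app W \<rho> n \<noteq> app W \<eta> n)"
  shows "\<exists>X\<in>elems W.
           ext W X \<subseteq> ext W (omega W) \<and> \<not> finite_in W (ext W X) \<and>
           (\<forall>f\<in>baire W \<inter> elems V.
              (\<forall>n\<in>ext W (omega W). n \<epsilon>\<^bsub>W\<^esub> app W f n) \<longrightarrow>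
              finite_in W {m \<in> ext W X. app W f m \<in> ext W X}) \<and>
           (\<exists>Y\<in>elems W. ext W Y = ext W (omega W) - ext W X \<and> large_2_0 V W Y)"
proof -
  interpret universe_extension V W
    using assms(1-3) by unfold_locales
  obtain \<eta> where "\<eta> \<in> product W h"
    "\<forall>\<rho>\<in>product W h \<inter> elems V. almost_all W (\<lambda>n. app W \<rho> n \<noteq> app W \<eta> n)"
    using assms(6) by blast
  then obtain X where X: "X \<in> elems W" "ext W X \<subseteq> N" "\<not> finite_in W (ext W X)" "sparse X"
    using sparse_set_exists[of h \<eta>] assms(4) by blast
  have "finite_in W {m \<in> ext W X. app W f m \<in> ext W X}"
    if f: "f \<in> baire W \<inter> elems V" "\<forall>n\<in>N. n \<epsilon>\<^bsub>W\<^esub> app W f n" for f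
  proof -
    have f_fun: "function_on W f (omega W)" using f(1) by (simp add: baire_def)
    have "\<forall>n\<in>N. n \<in> ext W (app W f n)" using f(2) by (auto simp: ext_def)
    then obtain k where k: "k \<in> N" "\<forall>m\<in>ext W X. app W f m \<in> ext W X \<longrightarrow> m \<in> ext W k"
      using X(4) f(1) unfolding sparse_def by blast
    have "f \<in> elems W" using f(1) elems_sub by blast
    \<comment> \<open>A bound gives finiteness in \<open>W\<close> only for a set of
      \<open>W\<close>; the totalized application supplies the definability needed for
      Separation.\<close>
    then have "definable W (\<lambda>e. apply_in W f (e 0) \<in> ext W X)"
      by (intro definable_intros X(1))
    from W.separation[OF X(1) this] have "is_set W {m \<in> ext W X. apply_in W f m \<in> ext W X}" .
    moreover have "{m \<in> ext W X. apply_in W f m \<in> ext W X} = {m \<in> ext W X. app W f m \<in> ext W X}"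
      using W.apply_in_eq_app[OF f_fun] X(2) by auto
    ultimately show ?thesis using W.bounded_imp_finite_in[OF _ k(1)] k(2) by auto
  qed
  moreover have "is_set W {n \<in> N. n \<notin> ext W X}"
    by (rule W.separation[OF W.omega(1)], intro definable_intros X(1))
  then obtain Y where Y: "Y \<in> elems W" "ext W Y = N - ext W X"
    by (auto simp: is_set_def set_diff_eq)
  ultimately show ?thesis
    using X sparse_complement_large[OF X Y] by blast
qed

end
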